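(* Fix an integer $d\ge 3$ and $0<p<1$. Let $k=k(n)\le n$ be a sequence of positive integers with $$k(n)\gg\left(\frac{p}{1-p}\right)^{\frac1{2(d-1)}}\sqrt n ,$$ and let $(A,S)$ be sampled from $\mathrm{HPC}(n,d,k(n),p)$. Let $u$ be a unit eigenvector corresponding to the largest eigenvalue of $A-\mathbb E_0[A]$, and let $\hat S_n\subset[n]$ be the set of indices of the $k(n)$ largest entries of $(|u_i|)_{i=1}^n$ (ties broken arbitrarily). Then $\hat S_n$ achieves exact recovery: $$\lim_{n\to\infty}\mathbb P(\hat S_n=S)=1 .$$
   Context: Write $[n]=\{1,\dots,n\}$; $\binom{[n]}{d}$ is the family of $d$-element subsets of $[n]$. For positive sequences, $a_n\gg b_n$ means $b_n/a_n\to0$ as $n\to\infty$. Hypergraph planted clique model $\mathrm{HPC}(n,d,k,p)$, $0\le k\le n$: sample $S\subset[n]$ uniformly among subsets of size $k$; given $S$, sample independent $\{0,1\}$-valued random variables $(H_e)_{e\in\binom{[n]}{d}}$ with $\mathbb P(H_e=1)=1$ if $e\subset S$ and $\mathbb P(H_e=1)=p$ if $e\not\subset S$. The adjacency matrix $A\in\mathbb R^{n\times n}$ is $A_{ij}=\sum_{e:\{i,j\}\subset e}H_e$ for $i\ne j$ and $A_{ii}=0$. We write $(A,S)\sim\mathrm{HPC}(n,d,k,p)$. $\mathbb E_0[A]$ is the expectation of $A$ under the null model $k=0$: the symmetric matrix with zero diagonal and all off-diagonal entries equal to $\binom{n-2}{d-2}p$. *)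

theory Defs
  imports "HOL-Probability.Product_PMF" "Jordan_Normal_Form.Char_Poly"
begin

text \<open>
  Vertices are numbered \<open>0, \<dots>, n - 1\<close> instead of \<open>1, \<dots>, n\<close>, so that they are the row and
  column indices of matrices in \<^theory>\<open>Jordan_Normal_Form.Matrix\<close>.
\<close>

definition hyperedges :: "nat \<Rightarrow> nat \<Rightarrow> nat set set" where
  "hyperedges n d = {e. e \<subseteq> {0..<n} \<and> card e = d}"

definition adjacency :: "nat \<Rightarrow> nat \<Rightarrow> (nat set \<Rightarrow> bool) \<Rightarrow> real mat" where
  "adjacency n d H =
     Matrix.mat n n (\<lambda>(i, j). if i = j then 0
       else (\<Sum>e | e \<in> hyperedges n d \<and> {i, j} \<subseteq> e. of_bool (H e)))"

text \<open>
  The joint law of \<open>(A, S)\<close>; the uniform choice of \<open>S\<close> is meaningful only for \<open>k \<le> n\<close>.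
  Outside \<open>hyperedges n d\<close> the indicator \<open>H\<close> takes the irrelevant value \<open>False\<close>.
\<close>
definition HPC :: "nat \<Rightarrow> nat \<Rightarrow> nat \<Rightarrow> real \<Rightarrow> (real mat \<times> nat set) pmf" where
  "HPC n d k p =
     do {
       S \<leftarrow> pmf_of_set {S. S \<subseteq> {0..<n} \<and> card S = k};
       H \<leftarrow> Pi_pmf (hyperedges n d) False (\<lambda>e. bernoulli_pmf (if e \<subseteq> S then 1 else p));
       return_pmf (adjacency n d H, S)
     }"

definition null_mean :: "nat \<Rightarrow> nat \<Rightarrow> real \<Rightarrow> real mat" where
  "null_mean n d p =
     Matrix.mat n n (\<lambda>(i, j). measure_pmf.expectation (HPC n d 0 p) (\<lambda>(A, S). A $$ (i, j)))"

definition unit_top_eigenvector :: "real mat \<Rightarrow> real Matrix.vec \<Rightarrow> bool" where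
  "unit_top_eigenvector B u \<longleftrightarrow>
     scalar_prod u u = 1 \<and>
     (\<exists>l. eigenvector B u l \<and> (\<forall>m. eigenvalue B m \<longrightarrow> m \<le> l))"

text \<open>
  \<open>T\<close> is one of the possible index sets of the \<open>k\<close> largest entries of \<open>\<bar>u\<bar>\<close>; with ties at the
  threshold there are several.
\<close>
definition top_abs_entries :: "nat \<Rightarrow> real Matrix.vec \<Rightarrow> nat set \<Rightarrow> bool" where
  "top_abs_entries k u T \<longleftrightarrow>
     T \<subseteq> {0..<dim_vec u} \<and> card T = k \<and>
     (\<forall>i\<in>T. \<forall>j\<in>{0..<dim_vec u} - T. \<bar>vec_index u j\<bar> \<le> \<bar>vec_index u i\<bar>)"

lemma finite_hyperedges: "finite (hyperedges n d)"
  by (rule finite_subset[of _ "Pow {0..<n}"]) (auto simp: hyperedges_def)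

lemma card_hyperedges_containing:
  assumes "i < n" "j < n" "i \<noteq> j" "d \<ge> 2"
  shows "card {e \<in> hyperedges n d. {i, j} \<subseteq> e} = (n - 2) choose (d - 2)"
proof -
  let ?B = "{e. e \<subseteq> {0..<n} - {i, j} \<and> card e = d - 2}"
  have "bij_betw (\<lambda>e. e - {i, j}) {e \<in> hyperedges n d. {i, j} \<subseteq> e} ?B"
  proof (rule bij_betwI[where g = "\<lambda>e. e \<union> {i, j}"])
    show "(\<lambda>e. e - {i, j}) \<in> {e \<in> hyperedges n d. {i, j} \<subseteq> e} \<rightarrow> ?B"
      using assms by (auto simp: hyperedges_def card_Diff_subset)
    show "(\<lambda>e. e \<union> {i, j}) \<in> ?B \<rightarrow> {e \<in> hyperedges n d. {i, j} \<subseteq> e}"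
    proof
      fix e assume e: "e \<in> ?B"
      hence "finite e" by (intro finite_subset[of e "{0..<n}"]) auto
      hence "card (e \<union> {i, j}) = card e + card {i, j}"
        using e by (intro card_Un_disjoint) auto
      thus "e \<union> {i, j} \<in> {e \<in> hyperedges n d. {i, j} \<subseteq> e}"
        using e assms by (auto simp: hyperedges_def)
    qed
  qed auto
  hence "card {e \<in> hyperedges n d. {i, j} \<subseteq> e} = card ?B"
    by (rule bij_betw_same_card)
  also have "\<dots> = card ({0..<n} - {i, j}) choose (d - 2)"
    by (rule n_subsets) simp
  also have "card ({0..<n} - {i, j}) = n - 2"
    using assms by (simp add: card_Diff_subset)
  finally show ?thesis .
qed

lemma null_mean_eq:
  assumes "d \<ge> 2" "0 \<le> p" "p \<le> 1"
  shows "null_mean n d p =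
           Matrix.mat n n (\<lambda>(i, j). if i = j then 0 else real ((n - 2) choose (d - 2)) * p)"
proof -
  let ?P = "Pi_pmf (hyperedges n d) False (\<lambda>e. bernoulli_pmf p)"
  have empty: "{S. S \<subseteq> {0..<n} \<and> card S = 0} = {{}}"
    by (auto dest: finite_subset)
  have "Pi_pmf (hyperedges n d) False (\<lambda>e. bernoulli_pmf (if e \<subseteq> {} then 1 else p)) = ?P"
    by (rule Pi_pmf_cong) (use assms in \<open>auto simp: hyperedges_def\<close>)
  hence HPC0: "HPC n d 0 p = map_pmf (\<lambda>H. (adjacency n d H, {})) ?P"
    unfolding HPC_def empty by (simp add: pmf_of_set_singleton bind_return_pmf map_pmf_def)
  have comp: "measure_pmf.expectation ?P (\<lambda>H. of_bool (H e)) = p"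
    if "e \<in> hyperedges n d" for e
  proof -
    have "measure_pmf.expectation ?P (\<lambda>H. of_bool (H e)) =
          measure_pmf.expectation (map_pmf (\<lambda>H. H e) ?P) (of_bool :: bool \<Rightarrow> real)"
      by simp
    also have "map_pmf (\<lambda>H. H e) ?P = bernoulli_pmf p"
      using that finite_hyperedges by (simp add: Pi_pmf_component)
    finally show ?thesis using assms by simp
  qed
  have "measure_pmf.expectation (HPC n d 0 p) (\<lambda>(A, S). A $$ (i, j)) =
        (if i = j then 0 else real ((n - 2) choose (d - 2)) * p)" if "i < n" "j < n" for i j
  proof (cases "i = j")
    case True
    thus ?thesis using that by (simp add: HPC0 adjacency_def)
  next
    case False
    have "measure_pmf.expectation (HPC n d 0 p) (\<lambda>(A, S). A $$ (i, j)) =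
          measure_pmf.expectation ?P
            (\<lambda>H. \<Sum>e | e \<in> hyperedges n d \<and> {i, j} \<subseteq> e. of_bool (H e))"
      using that False by (simp add: HPC0 adjacency_def)
    also have "\<dots> = (\<Sum>e | e \<in> hyperedges n d \<and> {i, j} \<subseteq> e.
                 measure_pmf.expectation ?P (\<lambda>H. of_bool (H e)))"
      by (intro Bochner_Integration.integral_sum measure_pmf.integrable_const_bound[where B = 1])
         auto
    also have "\<dots> = (\<Sum>e | e \<in> hyperedges n d \<and> {i, j} \<subseteq> e. p)"
      by (intro sum.cong refl comp) auto
    also have "\<dots> = real ((n - 2) choose (d - 2)) * p"
      using card_hyperedges_containing[OF that False assms(1)] by simp
    finally show ?thesis using False by simp
  qed
  thus ?thesis
    unfolding null_mean_def by (intro Matrix.eq_matI) auto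
qed

end

theory Submission
  imports Defs "HOL-Probability.Hoeffding" "HOL-Real_Asymp.Real_Asymp"
begin

text \<open>
  Condition on the clique \<open>S\<close>, let \<open>v\<close> be the unit vector proportional to its indicator and put
  \<open>a = (1 - p) * ((k - 2) choose (d - 2))\<close>. The centred adjacency matrix is \<open>a k\<close> times the projection
  onto \<open>v\<close>, a diagonal correction of norm \<open>a\<close>, and a noise matrix \<open>W\<close> whose entry at \<open>(i, j)\<close> is the sum
  of the centred edge variables over all edges containing \<open>i\<close> and \<open>j\<close>. A union bound over lattice points
  of the unit ball, with Hoeffding's inequality for each quadratic form, gives \<open>\<parallel>W\<parallel> = O(sqrt n ^ (d - 1))\<close>
  with high probability and without a logarithmic factor (\<open>codegree_matrix_norm_tail\<close>).
  Since \<open>k\<close> is much larger than \<open>sqrt n\<close>, this is negligible against the signal \<open>a k\<close>, which is of order \<open>k ^ (d - 1)\<close>. Hence the top eigenvector \<open>u\<close>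
  is close to a multiple of \<open>v\<close> in the Euclidean norm.

  Exact recovery needs closeness in every single coordinate. Scale \<open>u\<close> to have inner product \<open>1\<close> with
  \<open>v\<close>. The eigenvalue equation at coordinate \<open>i\<close> then shows that it is enough to bound
  \<open>(W u) i\<close> by a quarter of \<open>a * sqrt k\<close> (\<open>aligned_eigenvector_separates\<close>). The bound \<open>\<parallel>W\<parallel> \<parallel>u - v\<parallel>\<close> is too weak for this,
  and row \<open>i\<close> of \<open>W\<close> is not independent of \<open>u\<close>. So \<open>u\<close> is compared with the top eigenvector \<open>u'\<close> of the
  matrix in which the noise of all edges through \<open>i\<close> has been deleted. Row \<open>i\<close> of \<open>W\<close> consists of
  exactly these edges and is independent of \<open>u'\<close>, so, given \<open>u'\<close>, the number \<open>(W u') i\<close> is a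
  sum of independent terms and fluctuates only on the scale \<open>sqrt n ^ (d - 2)\<close>
  (\<open>leave_one_out_row_tail\<close>).

  It remains to bound \<open>u - u'\<close>. With \<open>u'\<close> scaled in the same way, an
  elementary perturbation argument bounds \<open>\<parallel>u - u'\<parallel>\<close> by \<open>3 \<parallel>z\<parallel> / (a k)\<close>, where \<open>z\<close> is the image of \<open>u'\<close>
  under the deleted part of the noise (\<open>aligned_eigenvector_perturbation\<close>). That image has three small
  pieces: the entry \<open>(W u') i\<close>, column \<open>i\<close> of \<open>W\<close> times \<open>u' i\<close>, where \<open>u' i\<close> has order at most
  \<open>1 / sqrt k\<close>, and the codegree matrix of the link of \<open>i\<close>, a \<open>(d - 1)\<close>-uniform hypergraph with norm
  \<open>O(sqrt n ^ (d - 2))\<close>. Multiplying \<open>\<parallel>u - u'\<parallel>\<close> by \<open>\<parallel>W\<parallel>\<close> yields a small multiple of \<open>a * sqrt k\<close>, as required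
  (\<open>leave_one_out_entry_bound\<close>).
\<close>

section \<open>Vectors and matrices over a finite index set\<close>

text \<open>
  The dimension \<open>n\<close> tends to infinity, so vectors are functions and the dimension is the size of an
  explicit finite index set \<open>I\<close>.
\<close>

definition dotp :: "'a set \<Rightarrow> ('a \<Rightarrow> real) \<Rightarrow> ('a \<Rightarrow> real) \<Rightarrow> real" where
  "dotp I x y = (\<Sum>i\<in>I. x i * y i)"

definition mat_apply :: "'a set \<Rightarrow> ('a \<Rightarrow> 'a \<Rightarrow> real) \<Rightarrow> ('a \<Rightarrow> real) \<Rightarrow> 'a \<Rightarrow> real" where
  "mat_apply I M x i = (\<Sum>j\<in>I. M i j * x j)"

definition sym_matrix :: "'a set \<Rightarrow> ('a \<Rightarrow> 'a \<Rightarrow> real) \<Rightarrow> bool" where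
  "sym_matrix I M \<longleftrightarrow> (\<forall>i\<in>I. \<forall>j\<in>I. M i j = M j i)"

lemma dotp_commute: "dotp I x y = dotp I y x"
  by (simp add: dotp_def mult.commute)

lemma dotp_add_left: "dotp I (\<lambda>i. x i + y i) z = dotp I x z + dotp I y z"
  by (simp add: dotp_def sum.distrib distrib_right)

lemma dotp_add_right: "dotp I z (\<lambda>i. x i + y i) = dotp I z x + dotp I z y"
  by (simp add: dotp_def sum.distrib distrib_left)

lemma dotp_diff_right: "dotp I z (\<lambda>i. x i - y i) = dotp I z x - dotp I z y"
  by (simp add: dotp_def sum_subtractf right_diff_distrib)

lemma dotp_diff_left: "dotp I (\<lambda>i. x i - y i) z = dotp I x z - dotp I y z"
  by (simp add: dotp_def sum_subtractf left_diff_distrib)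

lemma dotp_scale_left: "dotp I (\<lambda>i. c * x i) y = c * dotp I x y"
  by (simp add: dotp_def sum_distrib_left mult.assoc)

lemma dotp_scale_right: "dotp I x (\<lambda>i. c * y i) = c * dotp I x y"
  by (simp add: dotp_def sum_distrib_left mult_ac)

lemmas dotp_linear =
  dotp_add_left dotp_add_right dotp_diff_left dotp_diff_right dotp_scale_left dotp_scale_right

lemma dotp_cong: "(\<And>i. i \<in> I \<Longrightarrow> x i = x' i) \<Longrightarrow> (\<And>i. i \<in> I \<Longrightarrow> y i = y' i) \<Longrightarrow> dotp I x y = dotp I x' y'"
  by (simp add: dotp_def)

lemma dotp_self: "dotp I x x = (L2_set x I)\<^sup>2"
  by (simp add: dotp_def L2_set_def sum_nonneg power2_eq_square)

lemma dotp_cauchy_schwarz: "\<bar>dotp I x y\<bar> \<le> L2_set x I * L2_set y I"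
proof -
  have "\<bar>dotp I x y\<bar> \<le> (\<Sum>i\<in>I. \<bar>x i\<bar> * \<bar>y i\<bar>)"
    unfolding dotp_def abs_mult[symmetric] by (rule sum_abs)
  also have "\<dots> \<le> L2_set x I * L2_set y I"
    by (rule L2_set_mult_ineq)
  finally show ?thesis .
qed

lemma L2_set_scale: "L2_set (\<lambda>i. c * x i) I = \<bar>c\<bar> * L2_set x I"
  by (simp add: L2_set_def power_mult_distrib real_sqrt_mult sum_distrib_left[symmetric])

lemma L2_set_triangle_diff: "L2_set (\<lambda>i. x i - y i) I \<le> L2_set x I + L2_set y I"
  using L2_set_triangle_ineq[of x "\<lambda>i. - 1 * y i" I] L2_set_scale[of "-1" y I] by simp

lemma mat_apply_add: "mat_apply I M (\<lambda>i. x i + y i) = (\<lambda>i. mat_apply I M x i + mat_apply I M y i)"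
  by (simp add: mat_apply_def fun_eq_iff sum.distrib distrib_left)

lemma mat_apply_diff: "mat_apply I M (\<lambda>i. x i - y i) = (\<lambda>i. mat_apply I M x i - mat_apply I M y i)"
  by (simp add: mat_apply_def fun_eq_iff sum_subtractf right_diff_distrib)

lemma mat_apply_scale: "mat_apply I M (\<lambda>i. c * x i) = (\<lambda>i. c * mat_apply I M x i)"
  by (simp add: mat_apply_def fun_eq_iff sum_distrib_left mult_ac)

lemmas mat_apply_linear = mat_apply_add mat_apply_diff mat_apply_scale

lemma mat_apply_cong: "(\<And>j. j \<in> I \<Longrightarrow> x j = y j) \<Longrightarrow> mat_apply I M x i = mat_apply I M y i"
  by (simp add: mat_apply_def)

lemma dotp_mat_apply_sym:
  assumes "sym_matrix I M"
  shows "dotp I x (mat_apply I M y) = dotp I y (mat_apply I M x)"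
proof -
  have "dotp I x (mat_apply I M y) = (\<Sum>i\<in>I. \<Sum>j\<in>I. x i * (M i j * y j))"
    by (simp add: dotp_def mat_apply_def sum_distrib_left)
  also have "\<dots> = (\<Sum>j\<in>I. \<Sum>i\<in>I. x i * (M i j * y j))"
    by (rule sum.swap)
  also have "\<dots> = (\<Sum>j\<in>I. \<Sum>i\<in>I. y j * (M j i * x i))"
    using assms by (intro sum.cong refl) (simp add: sym_matrix_def)
  finally show ?thesis
    by (simp add: dotp_def mat_apply_def sum_distrib_left)
qed

section \<open>Top eigenvectors and operator norms of symmetric matrices\<close>

text \<open>
  The box \<open>[-1, 1]\<close> to the power \<open>I\<close> is compact by Tychonoff, and the sphere is a closed subset of
  it. Fixing the coordinates outside \<open>I\<close> to \<open>0\<close> makes the product topology on all functions usable.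
\<close>
lemma compact_unit_sphere:
  assumes "finite I"
  shows "compact {x :: 'a \<Rightarrow> real. (\<forall>i. i \<notin> I \<longrightarrow> x i = 0) \<and> dotp I x x = 1}" (is "compact ?S")
proof -
  let ?B = "PiE UNIV (\<lambda>i. if i \<in> I then {-1..1} else {0}) :: ('a \<Rightarrow> real) set"
  have "compactin (product_topology (\<lambda>i. euclidean) UNIV) ?B"
    by (subst compactin_PiE) auto
  hence B: "compact ?B"
    by (simp add: euclidean_product_topology)
  have "closed {x :: 'a \<Rightarrow> real. dotp I x x = 1}"
    unfolding dotp_def
    by (intro closed_Collect_eq continuous_on_sum continuous_on_mult continuous_on_const
        continuous_on_product_coordinates)
  hence "compact (?B \<inter> {x. dotp I x x = 1})"
    using B by (rule compact_Int_closed[rotated])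
  also have "?B \<inter> {x. dotp I x x = 1} = ?S"
  proof -
    have "\<bar>x i\<bar> \<le> 1" if "dotp I x x = 1" "i \<in> I" for x :: "'a \<Rightarrow> real" and i
    proof -
      have "(x i)\<^sup>2 \<le> (\<Sum>i\<in>I. (x i)\<^sup>2)"
        using that assms by (intro member_le_sum) auto
      thus ?thesis
        using that by (simp add: dotp_def power2_eq_square flip: abs_square_le_1)
    qed
    hence sub: "x i \<in> (if i \<in> I then {-1..1} else {0})" if "x \<in> ?S" for x i
      using that by (auto simp: abs_le_iff minus_le_iff)
    have "x \<in> ?B" if "x \<in> ?S" for x
      using sub[OF that] by (intro PiE_I) auto
    moreover have "x i = 0" if "x \<in> ?B" "i \<notin> I" for x i
      using PiE_mem[OF that(1), of i] that(2) by simp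
    ultimately show ?thesis
      by blast
  qed
  finally show ?thesis .
qed

lemma linear_coeff_zero:
  fixes b c :: real
  assumes "\<And>t. 0 \<le> t * b + t\<^sup>2 * c"
  shows "b = 0"
proof (rule ccontr)
  assume b: "b \<noteq> 0"
  define s where "s = 1 / (\<bar>c\<bar> + 1)"
  have s: "0 < s" "s * c < 1"
    unfolding s_def by (auto simp: field_simps)
  have "0 \<le> (- b * s) * b + (- b * s)\<^sup>2 * c" by (rule assms)
  also have "\<dots> = b\<^sup>2 * s * (s * c - 1)"
    by (simp add: power2_eq_square algebra_simps)
  also have "\<dots> < 0"
    using b s by (intro mult_pos_neg mult_pos_pos) auto
  finally show False by simp
qed

text \<open>
  The quadratic form attains its maximum \<open>m\<close> on the sphere at some \<open>x\<close>. By homogeneity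
  \<open>m * dotp y y\<close> minus the form is nonnegative everywhere and vanishes at \<open>x\<close>; its first-order term
  at \<open>x\<close> must therefore vanish in each coordinate direction, which is the eigenvalue equation.
  The variational bound matters as much as the eigenvector: it is what turns the largest
  eigenvalue into a lower bound for quadratic forms.
\<close>
lemma top_eigenvector_exists:
  assumes "finite I" and "I \<noteq> {}" and sym: "sym_matrix I M"
  obtains x m where "dotp I x x = 1" and "\<And>i. i \<in> I \<Longrightarrow> mat_apply I M x i = m * x i"
    and "\<And>y. dotp I y (mat_apply I M y) \<le> m * dotp I y y"
proof -
  define S where "S = {x :: 'a \<Rightarrow> real. (\<forall>i. i \<notin> I \<longrightarrow> x i = 0) \<and> dotp I x x = 1}"
  obtain a where a: "a \<in> I" using assms by auto
  have single: "dotp I y (\<lambda>i. if i = j then c else 0) = c * y j" if "j \<in> I" for y j c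
    using that assms(1) by (simp add: dotp_def if_distrib cong: if_cong)
  have "(\<lambda>i. if i = a then 1 else 0) \<in> S"
    using a single[OF a, of "\<lambda>i. if i = a then 1 else 0" 1] by (auto simp: S_def)
  hence ne: "S \<noteq> {}" by auto
  have compact: "compact S"
    unfolding S_def by (rule compact_unit_sphere) fact
  have "continuous_on S (\<lambda>x. dotp I x (mat_apply I M x))"
    unfolding dotp_def mat_apply_def
    by (intro continuous_on_sum continuous_on_mult continuous_on_const
        continuous_on_subset[OF continuous_on_product_coordinates] subset_UNIV)
  then obtain x where x: "x \<in> S" and
    max: "\<And>y. y \<in> S \<Longrightarrow> dotp I y (mat_apply I M y) \<le> dotp I x (mat_apply I M x)"
    using continuous_attains_sup[OF compact ne] by blast
  define m where "m = dotp I x (mat_apply I M x)"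
  have bound: "dotp I y (mat_apply I M y) \<le> m * dotp I y y" for y
  proof (cases "L2_set y I = 0")
    case True
    hence "\<forall>i\<in>I. y i = 0" using assms(1) by (simp add: L2_set_eq_0_iff)
    thus ?thesis by (simp add: dotp_def)
  next
    case False
    define s where "s = L2_set y I"
    have s: "s > 0" using False L2_set_nonneg[of y I] unfolding s_def by linarith
    define z where "z = (\<lambda>i. if i \<in> I then y i / s else 0)"
    have yz: "y i = s * z i" if "i \<in> I" for i using that s by (simp add: z_def)
    have yy: "dotp I y y = s\<^sup>2 * dotp I z z"
      using dotp_cong[OF yz yz, of I] by (simp add: dotp_linear power2_eq_square)
    hence "dotp I z z = 1"
      using s by (simp add: dotp_self s_def)
    hence "dotp I z (mat_apply I M z) \<le> m"
      unfolding m_def by (intro max) (simp add: z_def S_def)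
    moreover have "mat_apply I M y i = s * mat_apply I M z i" for i
      using mat_apply_cong[OF yz] by (simp add: mat_apply_scale)
    hence "dotp I y (mat_apply I M y) = s\<^sup>2 * dotp I z (mat_apply I M z)"
      using dotp_cong[of I y "\<lambda>i. s * z i" "mat_apply I M y" "\<lambda>i. s * mat_apply I M z i"] yz
      by (simp add: dotp_linear power2_eq_square)
    ultimately show ?thesis
      using s by (simp add: yy \<open>dotp I z z = 1\<close>)
  qed
  have "mat_apply I M x j = m * x j" if j: "j \<in> I" for j
  proof -
    define e where "e = (\<lambda>i. if i = j then 1 else (0::real))"
    have "0 \<le> t * (2 * (m * dotp I x e - dotp I e (mat_apply I M x))) +
              t\<^sup>2 * (m * dotp I e e - dotp I e (mat_apply I M e))" for t
    proof -
      have "0 \<le> m * dotp I (\<lambda>i. x i + t * e i) (\<lambda>i. x i + t * e i) -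
             dotp I (\<lambda>i. x i + t * e i) (mat_apply I M (\<lambda>i. x i + t * e i))"
        using bound by simp
      also have "\<dots> = t * (2 * (m * dotp I x e - dotp I e (mat_apply I M x))) +
              t\<^sup>2 * (m * dotp I e e - dotp I e (mat_apply I M e))"
        using x dotp_mat_apply_sym[OF sym, of x e]
        by (simp add: S_def dotp_linear mat_apply_linear m_def[symmetric] dotp_commute[of I e x]
            power2_eq_square algebra_simps)
      finally show ?thesis .
    qed
    hence "2 * (m * dotp I x e - dotp I e (mat_apply I M x)) = 0"
      by (rule linear_coeff_zero)
    thus ?thesis
      using single[OF j, of x 1] single[OF j, of "mat_apply I M x" 1]
      by (simp add: e_def dotp_commute[of I _ "mat_apply I M x"])
  qed
  with that[of x m] x bound show thesis by (simp add: S_def)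
qed

definition op_bounded :: "'a set \<Rightarrow> ('a \<Rightarrow> 'a \<Rightarrow> real) \<Rightarrow> real \<Rightarrow> bool" where
  "op_bounded I M r \<longleftrightarrow> (\<forall>x. L2_set (mat_apply I M x) I \<le> r * L2_set x I)"

lemma op_boundedD: "op_bounded I M r \<Longrightarrow> L2_set (mat_apply I M x) I \<le> r * L2_set x I"
  by (simp add: op_bounded_def)

text \<open>
  Polarisation: the bilinear form at \<open>x\<close> and \<open>y\<close> is a difference of two values of the quadratic form,
  and \<open>y\<close> is taken parallel to \<open>M x\<close> with the length of \<open>x\<close>.
\<close>
lemma op_bounded_if_quadratic_form_bounded:
  assumes "finite I" and sym: "sym_matrix I M"
    and q: "\<And>y. \<bar>dotp I y (mat_apply I M y)\<bar> \<le> r * dotp I y y"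
  shows "op_bounded I M r"
  unfolding op_bounded_def
proof
  fix x
  define b where "b = L2_set (mat_apply I M x) I"
  define a where "a = L2_set x I"
  show "b \<le> r * a"
  proof (cases "b = 0")
    case True
    have "0 \<le> r * a"
    proof (cases "a = 0")
      case False
      have "0 \<le> r * a\<^sup>2"
        using order_trans[OF abs_ge_zero q[of x]] by (simp add: dotp_self a_def)
      thus ?thesis
        using False by (simp add: zero_le_mult_iff a_def)
    qed simp
    thus ?thesis using True by simp
  next
    case False
    hence b: "b > 0" unfolding b_def using L2_set_nonneg[of "mat_apply I M x" I] by linarith
    have a: "a > 0"
    proof (rule ccontr)
      assume "\<not> a > 0"
      hence "a = 0" unfolding a_def using L2_set_nonneg[of x I] by linarith
      hence "\<forall>i\<in>I. x i = 0" using assms(1) by (simp add: L2_set_eq_0_iff a_def)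
      hence "b = 0" by (simp add: b_def mat_apply_def L2_set_def)
      thus False using b by simp
    qed
    define y where "y = (\<lambda>i. a / b * mat_apply I M x i)"
    have yx: "dotp I y (mat_apply I M x) = a * b"
      using b unfolding y_def dotp_scale_left dotp_self b_def[symmetric]
      by (simp add: power2_eq_square)
    have yy: "dotp I y y = a\<^sup>2"
      using b unfolding y_def dotp_scale_left dotp_scale_right dotp_self b_def[symmetric]
      by (simp add: power2_eq_square)
    have "4 * (a * b) = dotp I (\<lambda>i. x i + y i) (mat_apply I M (\<lambda>i. x i + y i)) -
                 dotp I (\<lambda>i. x i - y i) (mat_apply I M (\<lambda>i. x i - y i))"
      using dotp_mat_apply_sym[OF sym, of x y] yx by (simp add: dotp_linear mat_apply_linear)
    also have "\<dots> \<le> r * dotp I (\<lambda>i. x i + y i) (\<lambda>i. x i + y i) +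
                 r * dotp I (\<lambda>i. x i - y i) (\<lambda>i. x i - y i)"
      using q[of "\<lambda>i. x i + y i"] q[of "\<lambda>i. x i - y i"] by linarith
    also have "\<dots> = 2 * r * (dotp I x x + dotp I y y)"
      by (simp add: dotp_linear dotp_commute[of I y x] algebra_simps)
    also have "\<dots> = 4 * (a * (r * a))"
      unfolding yy by (simp add: dotp_self a_def[symmetric] power2_eq_square)
    finally show ?thesis using a by simp
  qed
qed

text \<open>
  A discrete substitute for the unit ball, over which a union bound is possible.
  The integer points are rescaled to mesh \<open>1 / (4 * sqrt N)\<close> in dimension \<open>N\<close>, so that a point of
  the ball is within distance \<open>1 / 4\<close> of a lattice point.
\<close>
definition lattice_points :: "'a set \<Rightarrow> ('a \<Rightarrow> int) set" where
  "lattice_points I = {z \<in> PiE I (\<lambda>_. {- int (16 * card I)..int (16 * card I)}).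
     (\<Sum>i\<in>I. (z i)\<^sup>2) \<le> int (16 * card I)}"

definition lattice_vector :: "'a set \<Rightarrow> ('a \<Rightarrow> int) \<Rightarrow> 'a \<Rightarrow> real" where
  "lattice_vector I z = (\<lambda>i. 1 / (4 * sqrt (real (card I))) * real_of_int (z i))"

lemma finite_lattice_points: "finite I \<Longrightarrow> finite (lattice_points I)"
  by (rule finite_subset[of _ "PiE I (\<lambda>_. {- int (16 * card I)..int (16 * card I)})"])
     (auto simp: lattice_points_def intro!: finite_PiE)

lemma norm_lattice_vector:
  assumes "z \<in> lattice_points I"
  shows "dotp I (lattice_vector I z) (lattice_vector I z) \<le> 1"
proof (cases "card I = 0")
  case False
  have "real_of_int (\<Sum>i\<in>I. (z i)\<^sup>2) \<le> real_of_int (int (16 * card I))"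
    using assms unfolding lattice_points_def by (simp only: of_int_le_iff) simp
  thus ?thesis
    using False unfolding lattice_vector_def dotp_scale_left dotp_scale_right
    by (simp add: dotp_def power2_eq_square field_simps mult.assoc[symmetric] del: mult.assoc)
qed (cases "finite I"; simp add: dotp_def)

lemma sum_half_powers_abs:
  "(\<Sum>m\<in>{- int b..int b}. (1 / 2 :: real) ^ nat \<bar>m\<bar>) = 3 - 2 * (1 / 2) ^ b"
proof (induction b)
  case (Suc b)
  have "{- int (Suc b)..int (Suc b)} = insert (int (Suc b)) (insert (- int (Suc b)) {- int b..int b})"
    by auto
  moreover have "nat (1 + int b) = Suc b" by simp
  ultimately show ?case
    using Suc by (simp del: of_nat_Suc)
qed simp

text \<open>
  Weight each integer point by \<open>2 powr (- (sum of its absolute values))\<close>. On the lattice points of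
  the ball this weight is at least \<open>2 powr (- 16 n)\<close>, because \<open>\<bar>m\<bar> \<le> m\<^sup>2\<close> for integers, while the total
  weight of all integer points factorises over the coordinates and is at most \<open>3 ^ n\<close>.
\<close>
lemma card_lattice_points:
  assumes "finite I"
  shows "real (card (lattice_points I)) \<le> exp (18 * real (card I))"
proof -
  define n where "n = card I"
  let ?B = "{- int (16 * n)..int (16 * n)}"
  have "real (card (lattice_points I)) = (\<Sum>z\<in>lattice_points I. 1)"
    by simp
  also have "\<dots> \<le> (\<Sum>z\<in>lattice_points I. 2 ^ (16 * n) * (\<Prod>i\<in>I. (1 / 2) ^ nat \<bar>z i\<bar>))"
  proof (rule sum_mono)
    fix z assume z: "z \<in> lattice_points I"
    have "int (\<Sum>i\<in>I. nat \<bar>z i\<bar>) \<le> (\<Sum>i\<in>I. (z i)\<^sup>2)"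
      unfolding of_nat_sum
    proof (rule sum_mono)
      fix i
      have "\<bar>z i\<bar> * 1 \<le> \<bar>z i\<bar> * \<bar>z i\<bar>"
        by (cases "z i = 0") (auto intro!: mult_left_mono simp del: abs_mult_self_eq)
      thus "int (nat \<bar>z i\<bar>) \<le> (z i)\<^sup>2"
        by (simp add: power2_eq_square)
    qed
    also have "\<dots> \<le> int (16 * n)" using z by (simp add: lattice_points_def n_def)
    finally have le: "(\<Sum>i\<in>I. nat \<bar>z i\<bar>) \<le> 16 * n"
      by linarith
    have "(1::real) = 2 ^ (16 * n) * (1 / 2) ^ (16 * n)"
      by (simp add: power_one_over)
    also have "\<dots> \<le> 2 ^ (16 * n) * (1 / 2) ^ (\<Sum>i\<in>I. nat \<bar>z i\<bar>)"
      using le by (intro mult_left_mono power_decreasing) auto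
    finally show "1 \<le> 2 ^ (16 * n) * (\<Prod>i\<in>I. (1 / 2 :: real) ^ nat \<bar>z i\<bar>)"
      by (simp add: power_sum)
  qed
  also have "\<dots> \<le> (\<Sum>z\<in>PiE I (\<lambda>_. ?B). 2 ^ (16 * n) * (\<Prod>i\<in>I. (1 / 2) ^ nat \<bar>z i\<bar>))"
    using assms by (intro sum_mono2) (auto intro!: finite_PiE prod_nonneg mult_nonneg_nonneg simp: lattice_points_def n_def)
  also have "\<dots> = 2 ^ (16 * n) * (\<Prod>i\<in>I. \<Sum>m\<in>?B. (1 / 2) ^ nat \<bar>m\<bar>)"
    using assms by (subst prod_sum_PiE) (auto simp: sum_distrib_left)
  also have "\<dots> = 2 ^ (16 * n) * (3 - 2 * (1 / 2) ^ (16 * n)) ^ n"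
    unfolding sum_half_powers_abs by (simp add: n_def)
  also have "\<dots> \<le> 2 ^ (16 * n) * 3 ^ n"
    by (intro mult_left_mono power_mono) (use power_le_one[of "1 / 2 :: real" "16 * n"] in auto)
  also have "\<dots> \<le> exp 1 ^ (16 * n) * exp 2 ^ n"
    using exp_ge_add_one_self[of 1] exp_ge_add_one_self[of "2::real"]
    by (intro mult_mono power_mono) auto
  also have "\<dots> = exp (18 * real n)"
    by (simp add: exp_of_nat_mult[symmetric] exp_add[symmetric])
  finally show ?thesis by (simp add: n_def)
qed

text \<open>
  Rounding every coordinate towards \<open>0\<close> does not increase the norm, so the rounded point stays in the
  ball; the error per coordinate is at most the mesh \<open>1 / (4 * sqrt n)\<close>.
\<close>
lemma round_to_lattice:
  assumes "finite I" and "I \<noteq> {}" and x: "dotp I x x = 1"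
  obtains z where "z \<in> lattice_points I" and "L2_set (\<lambda>i. x i - lattice_vector I z i) I \<le> 1 / 4"
proof -
  define s where "s = 4 * sqrt (real (card I))"
  have card: "card I > 0" using assms by (simp add: card_gt_0_iff)
  have s: "s > 0" "s\<^sup>2 = 16 * real (card I)" using card by (simp_all add: s_def power_mult_distrib)
  define w where "w i = (if x i \<ge> 0 then \<lfloor>s * x i\<rfloor> else \<lceil>s * x i\<rceil>)" for i
  have w: "\<bar>real_of_int (w i)\<bar> \<le> \<bar>s * x i\<bar>" "\<bar>s * x i - real_of_int (w i)\<bar> \<le> 1" for i
  proof -
    have "0 \<le> x i \<Longrightarrow> 0 \<le> s * x i" "x i \<le> 0 \<Longrightarrow> s * x i \<le> 0"
      using s(1) by (auto simp: mult_le_0_iff)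
    thus "\<bar>real_of_int (w i)\<bar> \<le> \<bar>s * x i\<bar>" "\<bar>s * x i - real_of_int (w i)\<bar> \<le> 1"
      unfolding w_def by (auto split: if_splits; linarith)+
  qed
  define z where "z = restrict w I"
  have "real_of_int (\<Sum>i\<in>I. (z i)\<^sup>2) = (\<Sum>i\<in>I. \<bar>real_of_int (w i)\<bar>\<^sup>2)"
    by (simp add: z_def)
  also have "\<dots> \<le> (\<Sum>i\<in>I. \<bar>s * x i\<bar>\<^sup>2)"
    by (intro sum_mono power_mono w) auto
  also have "\<dots> = s\<^sup>2 * dotp I x x"
    by (simp add: dotp_def power_mult_distrib sum_distrib_left power2_eq_square mult_ac)
  also have "\<dots> = real_of_int (int (16 * card I))"
    using s x by simp
  finally have sq: "(\<Sum>i\<in>I. (z i)\<^sup>2) \<le> int (16 * card I)"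
    unfolding of_int_le_iff .
  have "\<bar>z i\<bar> \<le> int (16 * card I)" if "i \<in> I" for i
  proof -
    have "\<bar>z i\<bar> \<le> (z i)\<^sup>2"
      using mult_left_mono[of 1 "\<bar>z i\<bar>" "\<bar>z i\<bar>"] by (cases "z i = 0") (auto simp: power2_eq_square)
    also have "\<dots> \<le> (\<Sum>i\<in>I. (z i)\<^sup>2)" using that assms by (intro member_le_sum) auto
    finally show ?thesis using sq by linarith
  qed
  hence z: "z \<in> lattice_points I"
    using sq unfolding lattice_points_def by (fastforce simp: z_def abs_le_iff)
  have "(L2_set (\<lambda>i. x i - lattice_vector I z i) I)\<^sup>2 = (\<Sum>i\<in>I. \<bar>s * x i - real_of_int (w i)\<bar>\<^sup>2 / s\<^sup>2)"
    unfolding L2_set_def using s(1)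
    by (simp add: sum_nonneg lattice_vector_def s_def[symmetric] z_def power_divide[symmetric]
        diff_divide_distrib)
  also have "\<dots> \<le> (\<Sum>i\<in>I. 1\<^sup>2 / s\<^sup>2)"
    by (intro sum_mono divide_right_mono power_mono w) auto
  also have "\<dots> = (1 / 4)\<^sup>2"
    unfolding s(2) using card by (simp add: power2_eq_square)
  finally have "L2_set (\<lambda>i. x i - lattice_vector I z i) I \<le> 1 / 4"
    by (rule power2_le_imp_le) simp
  with z show thesis by (rule that)
qed

text \<open>
  Take a unit eigenvector \<open>x\<close> whose eigenvalue has the largest modulus \<open>C\<close>, and its rounding
  \<open>x - \<delta>\<close>. As \<open>x\<close> is an eigenvector, the form at \<open>x - \<delta>\<close> differs from \<open>C\<close> or \<open>- C\<close> by at most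
  \<open>2 C \<parallel>\<delta>\<parallel> + C \<parallel>\<delta>\<parallel>\<^sup>2 \<le> C / 2 + C / 16\<close>. Hence some lattice value is at least \<open>7 C / 16\<close>.
\<close>
lemma op_bounded_if_bounded_on_lattice:
  assumes "finite I" and "I \<noteq> {}" and sym: "sym_matrix I M"
    and b: "\<And>z. z \<in> lattice_points I \<Longrightarrow>
      \<bar>dotp I (lattice_vector I z) (mat_apply I M (lattice_vector I z))\<bar> \<le> b"
  shows "op_bounded I M (16 / 7 * b)"
proof -
  have neg: "mat_apply I (\<lambda>i j. - M i j) x i = - mat_apply I M x i" for x i
    by (simp add: mat_apply_def sum_negf)
  have dneg: "dotp I y (mat_apply I (\<lambda>i j. - M i j) x) = - dotp I y (mat_apply I M x)" for x y
    by (simp add: neg dotp_def sum_negf)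
  have sym': "sym_matrix I (\<lambda>i j. - M i j)"
    using sym by (simp add: sym_matrix_def)
  obtain x1 m1 where x1: "dotp I x1 x1 = 1" "\<And>i. i \<in> I \<Longrightarrow> mat_apply I M x1 i = m1 * x1 i"
    and m1: "\<And>y. dotp I y (mat_apply I M y) \<le> m1 * dotp I y y"
    using top_eigenvector_exists[OF assms(1,2) sym] by blast
  obtain x2 m2 where x2: "dotp I x2 x2 = 1" "\<And>i. i \<in> I \<Longrightarrow> - mat_apply I M x2 i = m2 * x2 i"
    and m2: "\<And>y. - dotp I y (mat_apply I M y) \<le> m2 * dotp I y y"
    using top_eigenvector_exists[OF assms(1,2) sym'] unfolding dneg neg by blast
  define C where "C = max m1 m2"
  have q: "\<bar>dotp I y (mat_apply I M y)\<bar> \<le> C * dotp I y y" for y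
  proof -
    have "m1 * dotp I y y \<le> C * dotp I y y" "m2 * dotp I y y \<le> C * dotp I y y"
      unfolding C_def by (auto intro!: mult_right_mono simp: dotp_self)
    thus ?thesis using m1[of y] m2[of y] by linarith
  qed
  have C0: "C \<ge> 0" using order_trans[OF abs_ge_zero q[of x1]] x1(1) by simp
  obtain x m where x: "dotp I x x = 1" "\<And>i. i \<in> I \<Longrightarrow> mat_apply I M x i = m * x i" "\<bar>m\<bar> = C"
  proof (cases "m1 \<ge> m2")
    case True
    thus ?thesis using that[of x1 m1] x1 C0 by (simp add: C_def)
  next
    case False
    have "mat_apply I M x2 i = - m2 * x2 i" if "i \<in> I" for i using x2(2)[OF that] by simp
    thus ?thesis using that[of x2 "- m2"] x2 False C0 by (simp add: C_def)
  qed
  obtain z where z: "z \<in> lattice_points I"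
    and dz: "L2_set (\<lambda>i. x i - lattice_vector I z i) I \<le> 1 / 4"
    using round_to_lattice[OF assms(1,2) x(1)] .
  define \<delta> where "\<delta> = (\<lambda>i. x i - lattice_vector I z i)"
  have nx: "L2_set x I = 1"
    using x(1) L2_set_nonneg[of x I] unfolding dotp_self power2_eq_1_iff by linarith
  have xd: "\<bar>dotp I \<delta> x\<bar> \<le> 1 / 4"
    using dotp_cauchy_schwarz[of I \<delta> x] dz nx by (simp add: \<delta>_def)
  have dMx: "dotp I y (mat_apply I M x) = m * dotp I y x" for y
    using dotp_cong[of I y y "mat_apply I M x" "\<lambda>i. m * x i"] x(2) by (simp add: dotp_linear)
  have "dotp I \<delta> \<delta> \<le> (1 / 4)\<^sup>2"
    unfolding dotp_self \<delta>_def using dz by (intro power_mono) auto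
  hence "C * dotp I \<delta> \<delta> \<le> C * (1 / 4)\<^sup>2"
    using C0 by (intro mult_left_mono) auto
  hence dd: "\<bar>dotp I \<delta> (mat_apply I M \<delta>)\<bar> \<le> C / 16"
    using q[of \<delta>] by (simp add: power2_eq_square)
  have "lattice_vector I z = (\<lambda>i. x i - \<delta> i)" by (simp add: \<delta>_def)
  hence eq: "dotp I (lattice_vector I z) (mat_apply I M (lattice_vector I z)) =
        m - 2 * (m * dotp I \<delta> x) + dotp I \<delta> (mat_apply I M \<delta>)"
    using dotp_mat_apply_sym[OF sym, of x \<delta>] x(1)
    by (simp add: dotp_linear mat_apply_linear dMx)
  have "\<bar>m * dotp I \<delta> x\<bar> \<le> C * (1 / 4)"
    unfolding abs_mult x(3) using xd C0 by (intro mult_left_mono)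
  hence "C - 2 * (C * (1 / 4)) - C / 16 \<le> b"
    using b[OF z] dd x(3) unfolding eq by linarith
  hence "C \<le> 16 / 7 * b" by simp
  hence "C * dotp I y y \<le> 16 / 7 * b * dotp I y y" for y
    by (intro mult_right_mono) (simp_all add: dotp_self)
  thus ?thesis
    using q by (intro op_bounded_if_quadratic_form_bounded[OF assms(1) sym]) (meson order_trans)
qed

section \<open>Sums of independent Bernoulli variables\<close>

abbreviation bernoulli_product :: "'e set \<Rightarrow> ('e \<Rightarrow> real) \<Rightarrow> ('e \<Rightarrow> bool) pmf" where
  "bernoulli_product \<Omega> q \<equiv> Pi_pmf \<Omega> False (\<lambda>e. bernoulli_pmf (q e))"

definition centred :: "('e \<Rightarrow> real) \<Rightarrow> ('e \<Rightarrow> bool) \<Rightarrow> 'e \<Rightarrow> real" where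
  "centred q H e = of_bool (H e) - q e"

lemma prob_bind_pmf_le:
  assumes "\<And>x. x \<in> set_pmf p \<Longrightarrow> measure_pmf.prob (f x) A \<le> b" and "b \<ge> 0"
  shows "measure_pmf.prob (bind_pmf p f) A \<le> b"
proof -
  have "emeasure (measure_pmf (bind_pmf p f)) A = (\<integral>\<^sup>+x. emeasure (measure_pmf (f x)) A \<partial>measure_pmf p)"
    by (rule emeasure_bind_pmf)
  also have "\<dots> \<le> (\<integral>\<^sup>+x. ennreal b \<partial>measure_pmf p)"
    using assms by (intro nn_integral_mono_AE AE_pmfI) (auto simp: measure_pmf.emeasure_eq_measure)
  also have "\<dots> = ennreal b" by simp
  finally show ?thesis
    using assms(2) by (simp add: measure_pmf.emeasure_eq_measure)
qed

text \<open>
  Hoeffding's inequality. The case in which all coefficients vanish is separate because the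
  inequality divides by the sum of their squares.
\<close>
lemma bernoulli_sum_tail:
  assumes "finite \<Omega>" and "E \<subseteq> \<Omega>" and q: "\<And>e. e \<in> \<Omega> \<Longrightarrow> 0 \<le> q e \<and> q e \<le> 1"
    and V: "(\<Sum>e\<in>E. (c e)\<^sup>2) \<le> V" and t: "t \<ge> 0"
  shows "measure_pmf.prob (bernoulli_product \<Omega> q) {H. t < \<bar>\<Sum>e\<in>E. c e * centred q H e\<bar>}
    \<le> 2 * exp (- 2 * t\<^sup>2 / V)"
proof (cases "(\<Sum>e\<in>E. (c e)\<^sup>2) = 0")
  case True
  have "finite E" using assms by (blast intro: finite_subset)
  hence "\<forall>e\<in>E. c e = 0" using True by (simp add: sum_nonneg_eq_0_iff)
  hence "{H. t < \<bar>\<Sum>e\<in>E. c e * centred q H e\<bar>} = {}" using t by simp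
  thus ?thesis by (simp only: measure_empty) simp
next
  case False
  define P where "P = bernoulli_product \<Omega> q"
  have fE: "finite E" using assms by (blast intro: finite_subset)
  have pos: "(\<Sum>e\<in>E. (c e)\<^sup>2) > 0" using False by (simp add: order_less_le sum_nonneg)
  define a where "a e = min (c e * (1 - q e)) (- c e * q e)" for e
  define b where "b e = max (c e * (1 - q e)) (- c e * q e)" for e
  have ba: "(b e - a e)\<^sup>2 = (c e)\<^sup>2" for e
    unfolding a_def b_def by (cases "c e \<ge> 0") (auto simp: min_def max_def algebra_simps)
  have comp: "measure_pmf.expectation P (\<lambda>H. c e * centred q H e) = 0" if "e \<in> E" for e
  proof -
    have "e \<in> \<Omega>" using that assms by auto
    have "measure_pmf.expectation P (\<lambda>H. c e * centred q H e) =
        measure_pmf.expectation (map_pmf (\<lambda>H. H e) P) (\<lambda>h. c e * (of_bool h - q e))"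
      by (simp add: centred_def)
    also have "map_pmf (\<lambda>H. H e) P = bernoulli_pmf (q e)"
      using \<open>e \<in> \<Omega>\<close> assms(1) by (simp add: P_def Pi_pmf_component)
    finally show ?thesis
      using q[OF \<open>e \<in> \<Omega>\<close>] by (simp add: algebra_simps)
  qed
  interpret Hoeffding_ineq "measure_pmf P" E "\<lambda>e H. c e * centred q H e" a b 0
  proof unfold_locales
    have "prob_space.indep_vars (measure_pmf P) (\<lambda>_. count_space UNIV) (\<lambda>x f. f x) \<Omega>"
      unfolding P_def by (rule indep_vars_Pi_pmf) fact
    hence "prob_space.indep_vars (measure_pmf P) (\<lambda>_. count_space UNIV) (\<lambda>x f. f x) E"
      by (rule prob_space.indep_vars_subset[OF measure_pmf.prob_space_axioms]) fact
    thus "prob_space.indep_vars (measure_pmf P) (\<lambda>_. borel) (\<lambda>e H. c e * centred q H e) E"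
      unfolding centred_def by (rule prob_space.indep_vars_compose2[OF measure_pmf.prob_space_axioms]) auto
    show "AE H in measure_pmf P. c e * centred q H e \<in> {a e..b e}" if "e \<in> E" for e
      by (intro AE_pmfI) (auto simp: a_def b_def centred_def min_le_iff_disj le_max_iff_disj)
    show "0 \<equiv> \<Sum>e\<in>E. measure_pmf.expectation P (\<lambda>H. c e * centred q H e)"
      using comp by (simp only: sum.neutral_const cong: sum.cong)
  qed (use fE in auto)
  have "measure_pmf.prob P {H. t < \<bar>\<Sum>e\<in>E. c e * centred q H e\<bar>}
      \<le> measure_pmf.prob P {H \<in> space (measure_pmf P). t \<le> \<bar>(\<Sum>e\<in>E. c e * centred q H e) - 0\<bar>}"
    by (intro measure_pmf.finite_measure_mono) auto
  also have "\<dots> \<le> 2 * exp (- 2 * t\<^sup>2 / (\<Sum>e\<in>E. (c e)\<^sup>2))"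
    using Hoeffding_ineq_abs_ge[OF t] pos by (simp add: ba)
  also have "\<dots> \<le> 2 * exp (- 2 * t\<^sup>2 / V)"
    using V pos by (auto intro!: divide_left_mono mult_pos_pos)
  finally show ?thesis unfolding P_def .
qed

text \<open>
  The coefficients may be random as long as they depend only on the coordinates outside \<open>E\<close>:
  conditionally on these the variables in \<open>E\<close> are still independent and Hoeffding applies with
  fixed coefficients. This is the place where leaving one vertex out pays off.
\<close>
lemma bernoulli_sum_tail_conditional:
  assumes "finite \<Omega>" and "E \<subseteq> \<Omega>" and q: "\<And>e. e \<in> \<Omega> \<Longrightarrow> 0 \<le> q e \<and> q e \<le> 1"
    and V: "\<And>H. (\<Sum>e\<in>E. (c H e)\<^sup>2) \<le> V" and t: "t \<ge> 0"
  shows "measure_pmf.prob (bernoulli_product \<Omega> q)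
      {H. t < \<bar>\<Sum>e\<in>E. c (\<lambda>e. e \<notin> E \<and> H e) e * centred q H e\<bar>} \<le> 2 * exp (- 2 * t\<^sup>2 / V)"
proof -
  let ?D = "\<Omega> - E"
  have fin: "finite E" "finite ?D" using assms by (blast intro: finite_subset)+
  have "bernoulli_product \<Omega> q = bernoulli_product (?D \<union> E) q"
    using assms(2) by (simp add: Un_absorb2)
  also have "\<dots> = map_pmf (\<lambda>(f, g) x. if x \<in> ?D then f x else g x)
      (pair_pmf (bernoulli_product ?D q) (bernoulli_product E q))"
    using fin by (intro Pi_pmf_union) auto
  also have "\<dots> = bind_pmf (bernoulli_product ?D q)
      (\<lambda>f. map_pmf (\<lambda>g x. if x \<in> ?D then f x else g x) (bernoulli_product E q))"
    by (simp add: pair_pmf_def map_bind_pmf map_pmf_def bind_assoc_pmf bind_return_pmf)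
  finally have eq: "bernoulli_product \<Omega> q = \<dots>" .
  show ?thesis
    unfolding eq
  proof (rule prob_bind_pmf_le)
    fix f assume "f \<in> set_pmf (bernoulli_product ?D q)"
    hence f: "\<And>e. e \<notin> ?D \<Longrightarrow> \<not> f e"
      using set_Pi_pmf_subset[OF fin(2)] by fastforce
    have "(\<lambda>e. e \<notin> E \<and> (if e \<in> ?D then f e else g e)) = f"
      if "g \<in> set_pmf (bernoulli_product E q)" for g
      using f that set_Pi_pmf_subset[OF fin(1)] by (fastforce simp: fun_eq_iff)
    hence "measure_pmf.prob (map_pmf (\<lambda>g x. if x \<in> ?D then f x else g x) (bernoulli_product E q))
        {H. t < \<bar>\<Sum>e\<in>E. c (\<lambda>e. e \<notin> E \<and> H e) e * centred q H e\<bar>}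
      = measure_pmf.prob (bernoulli_product E q) {H. t < \<bar>\<Sum>e\<in>E. c f e * centred q H e\<bar>}"
      unfolding measure_map_pmf
      by (intro measure_pmf.finite_measure_eq_AE AE_pmfI) (simp_all add: centred_def)
    also have "\<dots> \<le> 2 * exp (- 2 * t\<^sup>2 / V)"
      using assms fin by (intro bernoulli_sum_tail) auto
    finally show "measure_pmf.prob (map_pmf (\<lambda>g x. if x \<in> ?D then f x else g x) (bernoulli_product E q))
        {H. t < \<bar>\<Sum>e\<in>E. c (\<lambda>e. e \<notin> E \<and> H e) e * centred q H e\<bar>} \<le> 2 * exp (- 2 * t\<^sup>2 / V)" .
  qed simp
qed

section \<open>Operator norm of a random codegree matrix\<close>

text \<open>
  The map \<open>f\<close> attaches a vertex set to each edge index. It is the identity for the adjacency matrix of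
  a hypergraph, and \<open>e \<mapsto> e - {i}\<close> for the link of the vertex \<open>i\<close>.
\<close>
definition codegree_matrix :: "'e set \<Rightarrow> ('e \<Rightarrow> 'a set) \<Rightarrow> ('e \<Rightarrow> real) \<Rightarrow> 'a \<Rightarrow> 'a \<Rightarrow> real" where
  "codegree_matrix E f X i j = (if i = j then 0 else \<Sum>e | e \<in> E \<and> {i, j} \<subseteq> f e. X e)"

lemma sym_codegree_matrix: "sym_matrix I (codegree_matrix E f X)"
  by (simp add: sym_matrix_def codegree_matrix_def insert_commute)

definition pair_sum :: "'a set \<Rightarrow> ('a \<Rightarrow> real) \<Rightarrow> real" where
  "pair_sum F x = (\<Sum>(i, j) | i \<in> F \<and> j \<in> F \<and> i \<noteq> j. x i * x j)"

lemma quadratic_form_codegree_matrix: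
  assumes "finite E" and "finite I" and sub: "\<And>e. e \<in> E \<Longrightarrow> f e \<subseteq> I"
  shows "dotp I x (mat_apply I (codegree_matrix E f X) x) = (\<Sum>e\<in>E. pair_sum (f e) x * X e)"
proof -
  have "codegree_matrix E f X i j = (\<Sum>e\<in>E. X e * of_bool (i \<noteq> j \<and> i \<in> f e \<and> j \<in> f e))" for i j
    using assms(1) unfolding codegree_matrix_def
    by (auto intro!: sum.mono_neutral_cong_left split: if_splits)
  hence "dotp I x (mat_apply I (codegree_matrix E f X) x) =
      (\<Sum>i\<in>I. \<Sum>j\<in>I. \<Sum>e\<in>E. X e * (of_bool (i \<noteq> j \<and> i \<in> f e \<and> j \<in> f e) * (x i * x j)))"
    by (simp add: dotp_def mat_apply_def sum_distrib_left sum_distrib_right mult_ac)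
  also have "\<dots> = (\<Sum>(i, j)\<in>I \<times> I. \<Sum>e\<in>E. X e * (of_bool (i \<noteq> j \<and> i \<in> f e \<and> j \<in> f e) * (x i * x j)))"
    by (rule sum.cartesian_product)
  also have "\<dots> = (\<Sum>e\<in>E. \<Sum>(i, j)\<in>I \<times> I. X e * (of_bool (i \<noteq> j \<and> i \<in> f e \<and> j \<in> f e) * (x i * x j)))"
    unfolding case_prod_unfold by (rule sum.swap)
  also have "\<dots> = (\<Sum>e\<in>E. pair_sum (f e) x * X e)"
  proof (rule sum.cong[OF refl])
    fix e assume "e \<in> E"
    hence s: "f e \<subseteq> I" by (rule sub)
    have "pair_sum (f e) x = (\<Sum>(i, j)\<in>I \<times> I. of_bool (i \<noteq> j \<and> i \<in> f e \<and> j \<in> f e) * (x i * x j))"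
      unfolding pair_sum_def using assms(2) s
      by (intro sum.mono_neutral_cong_left) auto
    thus "(\<Sum>(i, j)\<in>I \<times> I. X e * (of_bool (i \<noteq> j \<and> i \<in> f e \<and> j \<in> f e) * (x i * x j))) =
        pair_sum (f e) x * X e"
      by (simp add: sum_distrib_left case_prod_unfold mult_ac)
  qed
  finally show ?thesis .
qed

lemma pair_sum_squared_le:
  assumes "finite F" and "card F \<le> d"
  shows "(pair_sum F x)\<^sup>2 \<le> (real d)\<^sup>2 * (\<Sum>(i, j) | i \<in> F \<and> j \<in> F \<and> i \<noteq> j. (x i)\<^sup>2 * (x j)\<^sup>2)"
proof -
  let ?P = "{(i, j). i \<in> F \<and> j \<in> F \<and> i \<noteq> j}"
  have P: "?P \<subseteq> F \<times> F" by auto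
  have "card ?P \<le> card F * card F"
    using card_mono[OF _ P] assms(1) by (simp add: card_cartesian_product)
  also have "\<dots> \<le> d * d" using assms by (intro mult_le_mono)
  finally have c: "real (card ?P) \<le> (real d)\<^sup>2"
    by (simp add: power2_eq_square flip: of_nat_mult)
  have "(pair_sum F x)\<^sup>2 = (\<Sum>p\<in>?P. 1 * (x (fst p) * x (snd p)))\<^sup>2"
    by (simp add: pair_sum_def case_prod_unfold)
  also have "\<dots> \<le> (\<Sum>p\<in>?P. 1\<^sup>2) * (\<Sum>p\<in>?P. (x (fst p) * x (snd p))\<^sup>2)"
    by (rule Cauchy_Schwarz_ineq_sum)
  also have "\<dots> \<le> (real d)\<^sup>2 * (\<Sum>p\<in>?P. (x (fst p) * x (snd p))\<^sup>2)"
    using c by (intro mult_right_mono sum_nonneg) auto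
  finally show ?thesis by (simp add: case_prod_unfold power_mult_distrib)
qed

text \<open>
  The variance proxy of the quadratic form. After Cauchy--Schwarz inside each edge, every ordered pair
  of vertices is counted at most \<open>N\<close> times.
\<close>
lemma sum_pair_sum_squared_le:
  assumes "finite E" and "finite I" and sub: "\<And>e. e \<in> E \<Longrightarrow> f e \<subseteq> I \<and> card (f e) \<le> d"
    and N: "\<And>i j. i \<in> I \<Longrightarrow> j \<in> I \<Longrightarrow> i \<noteq> j \<Longrightarrow> card {e \<in> E. {i, j} \<subseteq> f e} \<le> N"
  shows "(\<Sum>e\<in>E. (pair_sum (f e) x)\<^sup>2) \<le> (real d)\<^sup>2 * real N * (dotp I x x)\<^sup>2"
proof -
  let ?c = "\<lambda>e i j. of_bool (i \<noteq> j \<and> i \<in> f e \<and> j \<in> f e) :: real"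
  have "(\<Sum>e\<in>E. (pair_sum (f e) x)\<^sup>2) \<le> 
    (\<Sum>e\<in>E. (real d)\<^sup>2 * (\<Sum>(i, j)\<in>I \<times> I. ?c e i j * ((x i)\<^sup>2 * (x j)\<^sup>2)))"
  proof (rule sum_mono)
    fix e assume "e \<in> E"
    hence s: "f e \<subseteq> I" "card (f e) \<le> d" using sub by auto
    have "(\<Sum>(i, j) | i \<in> f e \<and> j \<in> f e \<and> i \<noteq> j. (x i)\<^sup>2 * (x j)\<^sup>2) =
      (\<Sum>(i, j)\<in>I \<times> I. ?c e i j * ((x i)\<^sup>2 * (x j)\<^sup>2))"
      using assms(2) s by (intro sum.mono_neutral_cong_left) auto
    thus "(pair_sum (f e) x)\<^sup>2 \<le> (real d)\<^sup>2 * (\<Sum>(i, j)\<in>I \<times> I. ?c e i j * ((x i)\<^sup>2 * (x j)\<^sup>2))"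
      using pair_sum_squared_le[OF finite_subset[OF s(1) assms(2)] s(2), of x] by simp
  qed
  also have "\<dots> = (real d)\<^sup>2 * (\<Sum>(i, j)\<in>I \<times> I. (\<Sum>e\<in>E. ?c e i j) * ((x i)\<^sup>2 * (x j)\<^sup>2))"
    unfolding sum_distrib_left[symmetric] sum_distrib_right case_prod_unfold
    by (subst sum.swap) simp
  also have "\<dots> \<le> (real d)\<^sup>2 * (\<Sum>(i, j)\<in>I \<times> I. real N * ((x i)\<^sup>2 * (x j)\<^sup>2))"
  proof (intro mult_left_mono sum_mono)
    fix p assume p: "p \<in> I \<times> I"
    obtain i j where ij: "p = (i, j)" by (cases p)
    have "(\<Sum>e\<in>E. ?c e i j) \<le> real N"
    proof (cases "i = j")
      case False
      have "(\<Sum>e\<in>E. ?c e i j) = real (card {e \<in> E. {i, j} \<subseteq> f e})"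
        using assms(1) False by (simp add: of_bool_def sum.If_cases Int_def)
      thus ?thesis using N[of i j] p ij False by simp
    qed simp
    thus "(case p of (i, j) \<Rightarrow> (\<Sum>e\<in>E. ?c e i j) * ((x i)\<^sup>2 * (x j)\<^sup>2)) \<le>
        (case p of (i, j) \<Rightarrow> real N * ((x i)\<^sup>2 * (x j)\<^sup>2))"
      unfolding ij by (auto intro!: mult_right_mono)
  qed simp
  also have "(\<Sum>(i, j)\<in>I \<times> I. real N * ((x i)\<^sup>2 * (x j)\<^sup>2)) =
      real N * (\<Sum>(i, j)\<in>I \<times> I. (x i)\<^sup>2 * (x j)\<^sup>2)"
    by (simp add: sum_distrib_left case_prod_unfold)
  also have "(\<Sum>(i, j)\<in>I \<times> I. (x i)\<^sup>2 * (x j)\<^sup>2) = (dotp I x x)\<^sup>2"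
    by (simp add: dotp_def power2_eq_square sum_product sum.cartesian_product)
  finally show ?thesis by (simp add: mult.assoc)
qed

text \<open>
  For a fixed vector in the unit ball the quadratic form exceeds \<open>b = 7 / 2 * d * sqrt (N * n)\<close> with probability at
  most \<open>2 * exp (- 49 / 2 * n)\<close>, which beats the \<open>exp (18 * n)\<close> lattice points, and \<open>8 = 16 / 7 * 7 / 2\<close>.
  The absence of a logarithmic factor is essential, since the clique is only
  assumed to be much larger than \<open>sqrt n\<close>.
\<close>
lemma codegree_matrix_norm_tail:
  fixes q :: "'e \<Rightarrow> real" and f :: "'e \<Rightarrow> 'a set"
  assumes "finite \<Omega>" and "E \<subseteq> \<Omega>" and q: "\<And>e. e \<in> \<Omega> \<Longrightarrow> 0 \<le> q e \<and> q e \<le> 1"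
    and I: "finite I" "I \<noteq> {}" and sub: "\<And>e. e \<in> E \<Longrightarrow> f e \<subseteq> I \<and> card (f e) \<le> d"
    and N: "\<And>i j. i \<in> I \<Longrightarrow> j \<in> I \<Longrightarrow> i \<noteq> j \<Longrightarrow> card {e \<in> E. {i, j} \<subseteq> f e} \<le> N"
    and pos: "d > 0" "N > 0"
  shows "measure_pmf.prob (bernoulli_product \<Omega> q)
      {H. \<not> op_bounded I (codegree_matrix E f (centred q H)) (8 * real d * sqrt (real N * real (card I)))}
    \<le> 2 * exp (- real (card I))"
proof -
  let ?P = "bernoulli_product \<Omega> q"
  define n where "n = real (card I)"
  have n: "n \<ge> 1" using I by (simp add: n_def Suc_le_eq card_gt_0_iff)
  define b where "b = 7 / 2 * real d * sqrt (real N * n)"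
  have b2: "b\<^sup>2 = 49 / 4 * ((real d)\<^sup>2 * real N) * n"
    using n by (simp add: b_def power_mult_distrib power_divide)
  have fE: "finite E" using assms by (blast intro: finite_subset)
  define Bad where "Bad z = {H. b < \<bar>\<Sum>e\<in>E. pair_sum (f e) (lattice_vector I z) * centred q H e\<bar>}" for z
  have bad: "measure_pmf.prob ?P (Bad z) \<le> 2 * exp (- 19 * n)" if z: "z \<in> lattice_points I" for z
  proof -
    let ?x = "lattice_vector I z"
    have "(dotp I ?x ?x)\<^sup>2 \<le> 1"
      using norm_lattice_vector[OF z] by (intro power_le_one) (simp_all add: dotp_self)
    hence "(real d)\<^sup>2 * real N * (dotp I ?x ?x)\<^sup>2 \<le> (real d)\<^sup>2 * real N * 1"
      by (intro mult_left_mono) auto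
    hence "(\<Sum>e\<in>E. (pair_sum (f e) ?x)\<^sup>2) \<le> (real d)\<^sup>2 * real N"
      using sum_pair_sum_squared_le[OF fE I(1) sub N, of ?x] by simp
    hence "measure_pmf.prob ?P (Bad z) \<le> 2 * exp (- 2 * b\<^sup>2 / ((real d)\<^sup>2 * real N))"
      unfolding Bad_def using n by (intro bernoulli_sum_tail assms) (auto simp: b_def)
    also have "- 2 * b\<^sup>2 / ((real d)\<^sup>2 * real N) = - (49 / 2) * n"
      unfolding b2 using pos by (simp add: field_simps)
    also have "2 * exp (- (49 / 2) * n) \<le> 2 * exp (- 19 * n)"
      using n by simp
    finally show ?thesis .
  qed
  have "{H. \<not> op_bounded I (codegree_matrix E f (centred q H)) (8 * real d * sqrt (real N * n))}
      \<subseteq> (\<Union>z\<in>lattice_points I. Bad z)"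
  proof (rule ccontr)
    assume "\<not> ?thesis"
    then obtain H where H: "\<not> op_bounded I (codegree_matrix E f (centred q H)) (8 * real d * sqrt (real N * n))"
      and nb: "\<And>z. z \<in> lattice_points I \<Longrightarrow> H \<notin> Bad z" by blast
    have "op_bounded I (codegree_matrix E f (centred q H)) (16 / 7 * b)"
    proof (rule op_bounded_if_bounded_on_lattice[OF I sym_codegree_matrix])
      fix z assume "z \<in> lattice_points I"
      thus "\<bar>dotp I (lattice_vector I z) (mat_apply I (codegree_matrix E f (centred q H)) (lattice_vector I z))\<bar> \<le> b"
        using nb[of z] sub by (simp add: quadratic_form_codegree_matrix[OF fE I(1)] Bad_def not_less)
    qed
    thus False using H by (simp add: b_def mult.assoc)
  qed
  hence "measure_pmf.prob ?P {H. \<not> op_bounded I (codegree_matrix E f (centred q H)) (8 * real d * sqrt (real N * n))}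
      \<le> measure_pmf.prob ?P (\<Union>z\<in>lattice_points I. Bad z)"
    by (intro measure_pmf.finite_measure_mono) auto
  also have "\<dots> \<le> (\<Sum>z\<in>lattice_points I. measure_pmf.prob ?P (Bad z))"
    using finite_lattice_points[OF I(1)] by (intro measure_pmf.finite_measure_subadditive_finite) auto
  also have "\<dots> \<le> real (card (lattice_points I)) * (2 * exp (- 19 * n))"
    using sum_mono[of "lattice_points I" "\<lambda>z. measure_pmf.prob ?P (Bad z)" "\<lambda>_. 2 * exp (- 19 * n)"] bad
    by simp
  also have "\<dots> \<le> exp (18 * n) * (2 * exp (- 19 * n))"
    unfolding n_def by (intro mult_right_mono card_lattice_points I) auto
  also have "\<dots> = 2 * exp (- n)"
    by (simp add: mult.left_commute flip: exp_add)
  finally show ?thesis by (simp add: n_def)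
qed

section \<open>Top eigenvectors of a planted matrix\<close>

definition planted :: "real \<Rightarrow> 'a set \<Rightarrow> ('a \<Rightarrow> 'a \<Rightarrow> real) \<Rightarrow> 'a \<Rightarrow> 'a \<Rightarrow> real" where
  "planted a S W i j = W i j + (if i \<noteq> j \<and> i \<in> S \<and> j \<in> S then a else 0)"

text \<open>
  The unit vector in the direction of the indicator of \<open>S\<close>. The planted part equals
  \<open>a * card S\<close> times the projection onto it, minus \<open>a\<close> times the diagonal projection onto \<open>S\<close>; the
  latter is put into the residual.
\<close>
definition spike :: "'a set \<Rightarrow> 'a \<Rightarrow> real" where
  "spike S i = (if i \<in> S then 1 / sqrt (real (card S)) else 0)"

definition residual :: "real \<Rightarrow> 'a set \<Rightarrow> 'a set \<Rightarrow> ('a \<Rightarrow> 'a \<Rightarrow> real) \<Rightarrow> ('a \<Rightarrow> real) \<Rightarrow> 'a \<Rightarrow> real" where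
  "residual a S I W x i = mat_apply I W x i - (if i \<in> S then a * x i else 0)"

lemma dotp_spike_left:
  assumes "finite I" "S \<subseteq> I"
  shows "dotp I (spike S) x = sum x S / sqrt (real (card S))"
proof -
  have "dotp I (spike S) x = (\<Sum>i\<in>S. x i / sqrt (real (card S)))"
    unfolding dotp_def spike_def using assms by (intro sum.mono_neutral_cong_right) auto
  thus ?thesis by (simp add: sum_divide_distrib)
qed

lemma dotp_spike_self:
  assumes "finite I" "S \<subseteq> I" "S \<noteq> {}"
  shows "dotp I (spike S) (spike S) = 1"
proof -
  have "card S > 0" using assms by (simp add: card_gt_0_iff finite_subset)
  moreover have "sum (spike S) S = real (card S) / sqrt (real (card S))"
    by (simp add: spike_def)
  ultimately show ?thesis using assms by (simp add: dotp_spike_left)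
qed

lemma mat_apply_planted:
  assumes "finite I" "S \<subseteq> I" "S \<noteq> {}"
  shows "mat_apply I (planted a S W) x i =
    a * real (card S) * dotp I (spike S) x * spike S i + residual a S I W x i"
proof (cases "i \<in> S")
  case True
  have k: "card S > 0" using assms by (simp add: card_gt_0_iff finite_subset)
  have "(\<Sum>j\<in>I. (if i \<noteq> j \<and> i \<in> S \<and> j \<in> S then a else 0) * x j) = (\<Sum>j\<in>S - {i}. a * x j)"
    using True assms by (intro sum.mono_neutral_cong_right) auto
  also have "\<dots> = a * sum x S - a * x i"
    using True finite_subset[OF assms(2,1)]
    by (simp add: sum_diff1 sum_distrib_left[symmetric] right_diff_distrib)
  finally show ?thesis
    using True k
    by (simp add: mat_apply_def planted_def distrib_right sum.distrib residual_def spike_def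
        dotp_spike_left[OF assms(1,2)])
next
  case False
  thus ?thesis by (simp add: mat_apply_def planted_def residual_def spike_def)
qed

lemma residual_diff:
  "residual a S I W (\<lambda>i. x i - y i) = (\<lambda>i. residual a S I W x i - residual a S I W y i)"
  by (auto simp: residual_def mat_apply_diff fun_eq_iff right_diff_distrib)

lemma residual_norm:
  assumes "op_bounded I W \<rho>" and "a \<ge> 0"
  shows "L2_set (residual a S I W x) I \<le> (a + \<rho>) * L2_set x I"
proof -
  have "L2_set (\<lambda>i. if i \<in> S then a * x i else 0) I \<le> L2_set (\<lambda>i. a * x i) I"
    unfolding L2_set_def by (intro real_sqrt_le_mono sum_mono) auto
  also have "\<dots> = a * L2_set x I" using assms(2) by (simp add: L2_set_scale)
  finally have "L2_set (\<lambda>i. if i \<in> S then a * x i else 0) I \<le> a * L2_set x I" .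
  moreover have "L2_set (residual a S I W x) I \<le>
      L2_set (mat_apply I W x) I + L2_set (\<lambda>i. if i \<in> S then a * x i else 0) I"
    unfolding residual_def by (rule L2_set_triangle_diff)
  ultimately show ?thesis
    using op_boundedD[OF assms(1), of x] by (simp add: algebra_simps)
qed

text \<open>
  Eigenvectors are normalised by \<open>dotp I (spike S) y = 1\<close> rather than by their length. This fixes the
  sign, and the difference of two normalised vectors is orthogonal to the spike.
\<close>
definition aligned_eigenvector ::
    "real \<Rightarrow> 'a set \<Rightarrow> 'a set \<Rightarrow> ('a \<Rightarrow> 'a \<Rightarrow> real) \<Rightarrow> ('a \<Rightarrow> real) \<Rightarrow> real \<Rightarrow> bool" where
  "aligned_eigenvector a S I W y \<mu> \<longleftrightarrow>
     dotp I (spike S) y = 1 \<and> L2_set y I \<le> 11 / 10 \<and>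
     (\<forall>i\<in>I. mat_apply I (planted a S W) y i = \<mu> * y i) \<and>
     99 / 100 * (a * real (card S)) \<le> \<mu> \<and> \<mu> \<le> 101 / 100 * (a * real (card S))"

lemma norm_from_dotp: "dotp I x x = 1 \<Longrightarrow> L2_set x I = 1"
  using L2_set_nonneg[of x I] unfolding dotp_self power2_eq_1_iff by linarith

text \<open>
  The top eigenvalue \<open>\<mu>\<close> is at least the quadratic form at the spike, about \<open>l = a * card S\<close>. Evaluated
  at \<open>u\<close> the form is \<open>l * c\<^sup>2\<close> up to \<open>l / 100\<close>, so \<open>c\<close> is close to \<open>1\<close> in modulus.
\<close>
lemma top_eigenvector_aligned:
  assumes I: "finite I" "S \<subseteq> I" "S \<noteq> {}" and a: "a > 0"
    and W: "op_bounded I W \<rho>" and small: "a + \<rho> \<le> a * real (card S) / 100"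
    and u: "dotp I u u = 1" "\<And>i. i \<in> I \<Longrightarrow> mat_apply I (planted a S W) u i = \<mu> * u i"
    and top: "\<And>y. dotp I y (mat_apply I (planted a S W) y) \<le> \<mu> * dotp I y y"
  defines "c \<equiv> dotp I (spike S) u"
  shows "\<bar>1 / c\<bar> \<le> 11 / 10" and "c \<noteq> 0"
    and "aligned_eigenvector a S I W (\<lambda>i. 1 / c * u i) \<mu>"
proof -
  define l where "l = a * real (card S)"
  let ?v = "spike S" and ?R = "residual a S I W"
  have card: "card S > 0" using I by (simp add: card_gt_0_iff finite_subset)
  have l: "l > 0" using a card by (simp add: l_def)
  have nu: "L2_set u I = 1" and vv: "dotp I ?v ?v = 1" and nv: "L2_set ?v I = 1"
    using norm_from_dotp[OF u(1)] dotp_spike_self[OF I] norm_from_dotp by auto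
  have quad: "\<bar>dotp I x (?R x)\<bar> \<le> l / 100" if "L2_set x I = 1" for x
    using dotp_cauchy_schwarz[of I x "?R x"] residual_norm[OF W, of a S x] a small that
    by (simp add: l_def)
  have form: "dotp I x (mat_apply I (planted a S W) x) = l * (dotp I ?v x)\<^sup>2 + dotp I x (?R x)" for x
  proof -
    have "dotp I x (mat_apply I (planted a S W) x) =
        dotp I x (\<lambda>i. (l * dotp I ?v x) * ?v i + ?R x i)"
      by (intro dotp_cong) (simp_all add: mat_apply_planted[OF I] l_def)
    thus ?thesis
      by (simp only: dotp_linear) (simp add: dotp_commute[of I x ?v] power2_eq_square)
  qed
  have "99 / 100 * l \<le> dotp I ?v (mat_apply I (planted a S W) ?v)"
    using quad[OF nv] unfolding form vv by simp
  hence lower: "99 / 100 * l \<le> \<mu>" using top[of ?v] vv by simp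
  have "dotp I u (mat_apply I (planted a S W) u) = dotp I u (\<lambda>i. \<mu> * u i)"
    using u(2) by (intro dotp_cong) auto
  hence \<mu>: "\<mu> = l * c\<^sup>2 + dotp I u (?R u)"
    unfolding form c_def[symmetric] by (simp add: dotp_scale_right u(1))
  have c1: "\<bar>c\<bar> \<le> 1"
    using dotp_cauchy_schwarz[of I ?v u] nu nv by (simp add: c_def)
  have "c\<^sup>2 \<le> \<bar>c\<bar>"
    using mult_left_mono[OF c1, of "\<bar>c\<bar>"] by (simp add: power2_eq_square)
  hence lc: "l * c\<^sup>2 \<le> l * \<bar>c\<bar>" "l * \<bar>c\<bar> \<le> l * 1"
    using l c1 by (auto intro!: mult_left_mono)
  have upper: "\<mu> \<le> 101 / 100 * l"
    using lc quad[OF nu] unfolding \<mu> by linarith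
  have "l * (98 / 100) \<le> l * \<bar>c\<bar>"
    using lower lc quad[OF nu] unfolding \<mu> by linarith
  hence c: "98 / 100 \<le> \<bar>c\<bar>" using l by simp
  thus c0: "c \<noteq> 0" by auto
  show cb: "\<bar>1 / c\<bar> \<le> 11 / 10"
    using c by (simp add: abs_divide field_simps)
  have "dotp I ?v (\<lambda>i. 1 / c * u i) = 1"
    unfolding dotp_scale_right c_def[symmetric] using c0 by simp
  moreover have "L2_set (\<lambda>i. 1 / c * u i) I \<le> 11 / 10"
    unfolding L2_set_scale nu using cb by simp
  moreover have "mat_apply I (planted a S W) (\<lambda>i. 1 / c * u i) i = \<mu> * (1 / c * u i)" if "i \<in> I" for i
    unfolding mat_apply_scale u(2)[OF that] by simp
  ultimately show "aligned_eigenvector a S I W (\<lambda>i. 1 / c * u i) \<mu>"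
    using lower upper unfolding aligned_eigenvector_def l_def by blast
qed

text \<open>
  Write \<open>\<Delta> = y - y'\<close>, \<open>z = (W - W') y'\<close> and \<open>R\<close> for the residual of \<open>W\<close>. By the normalisation the
  rank-one terms cancel in the difference of the eigenvalue equations, which leaves
  \<open>\<mu> \<Delta> = R \<Delta> + z + (\<mu>' - \<mu>) y'\<close>. The inner product with the spike annihilates the left side and so
  bounds \<open>\<mu>' - \<mu>\<close> by \<open>\<parallel>R \<Delta>\<parallel> + \<parallel>z\<parallel>\<close>; inserting this bound back, \<open>\<mu>\<close> absorbs the small multiples of \<open>\<parallel>\<Delta>\<parallel>\<close>.
\<close>
lemma aligned_eigenvector_perturbation:
  assumes I: "finite I" "S \<subseteq> I" "S \<noteq> {}" and a: "a > 0"
    and W: "op_bounded I W \<rho>" and small: "a + \<rho> \<le> a * real (card S) / 100"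
    and y: "aligned_eigenvector a S I W y \<mu>" and y': "aligned_eigenvector a S I W' y' \<mu>'"
  shows "a * real (card S) * L2_set (\<lambda>i. y i - y' i) I
    \<le> 3 * L2_set (\<lambda>i. mat_apply I W y' i - mat_apply I W' y' i) I"
proof -
  define l where "l = a * real (card S)"
  define \<Delta> where "\<Delta> = (\<lambda>i. y i - y' i)"
  define z where "z = (\<lambda>i. mat_apply I W y' i - mat_apply I W' y' i)"
  define D where "D = L2_set \<Delta> I"
  define Z where "Z = L2_set z I"
  let ?v = "spike S" and ?R = "residual a S I W"
  have D0: "D \<ge> 0" by (simp add: D_def)
  have card: "card S > 0" using I by (simp add: card_gt_0_iff finite_subset)
  have l: "l > 0" using a card by (simp add: l_def)
  have nv: "L2_set ?v I = 1"
    using norm_from_dotp dotp_spike_self[OF I] by auto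
  have "L2_set (?R \<Delta>) I \<le> (a + \<rho>) * D"
    using residual_norm[OF W] a by (simp add: D_def)
  also have "\<dots> \<le> l / 100 * D"
    using small D0 by (intro mult_right_mono) (auto simp: l_def)
  finally have R: "L2_set (?R \<Delta>) I \<le> l / 100 * D" .
  have eq: "\<mu> * \<Delta> i = ?R \<Delta> i + z i + (\<mu>' - \<mu>) * y' i" if "i \<in> I" for i
  proof -
    have "\<mu> * y i = l * ?v i + ?R y i"
      using y that mat_apply_planted[OF I, of a W y i] by (simp add: aligned_eigenvector_def l_def)
    moreover have "\<mu>' * y' i = l * ?v i + residual a S I W' y' i"
      using y' that mat_apply_planted[OF I, of a W' y' i] by (simp add: aligned_eigenvector_def l_def)
    moreover have "residual a S I W' y' i = ?R y' i - z i"
      by (simp add: residual_def z_def)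
    ultimately show ?thesis
      by (simp add: \<Delta>_def residual_diff algebra_simps)
  qed
  have "dotp I ?v \<Delta> = 0"
    using y y' by (simp add: \<Delta>_def dotp_diff_right aligned_eigenvector_def)
  moreover have "dotp I ?v (\<lambda>i. \<mu> * \<Delta> i) = dotp I ?v (\<lambda>i. ?R \<Delta> i + z i + (\<mu>' - \<mu>) * y' i)"
    using eq by (intro dotp_cong) auto
  ultimately have "0 = dotp I ?v (?R \<Delta>) + dotp I ?v z + (\<mu>' - \<mu>)"
    using y' by (simp add: dotp_linear aligned_eigenvector_def)
  moreover have "\<bar>dotp I ?v (?R \<Delta>)\<bar> \<le> l / 100 * D" "\<bar>dotp I ?v z\<bar> \<le> Z"
    using dotp_cauchy_schwarz[of I ?v "?R \<Delta>"] dotp_cauchy_schwarz[of I ?v z] R nv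
    by (auto simp: Z_def)
  ultimately have gap: "\<bar>\<mu>' - \<mu>\<bar> \<le> l / 100 * D + Z"
    by linarith
  have "99 / 100 * l * D \<le> \<mu> * D"
    using y D0 by (intro mult_right_mono) (auto simp: aligned_eigenvector_def l_def)
  also have "\<dots> = L2_set (\<lambda>i. \<mu> * \<Delta> i) I"
    using y l by (simp add: L2_set_scale D_def aligned_eigenvector_def l_def)
  also have "\<dots> = L2_set (\<lambda>i. ?R \<Delta> i + z i + (\<mu>' - \<mu>) * y' i) I"
    using eq by (intro L2_set_cong) auto
  also have "\<dots> \<le> L2_set (\<lambda>i. ?R \<Delta> i + z i) I + L2_set (\<lambda>i. (\<mu>' - \<mu>) * y' i) I"
    by (rule L2_set_triangle_ineq)
  also have "\<dots> \<le> L2_set (?R \<Delta>) I + L2_set z I + \<bar>\<mu>' - \<mu>\<bar> * L2_set y' I"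
    by (simp add: L2_set_scale L2_set_triangle_ineq)
  also have "\<dots> \<le> l / 100 * D + Z + (l / 100 * D + Z) * (11 / 10)"
    using R gap y' by (intro add_mono mult_mono) (auto simp: Z_def aligned_eigenvector_def)
  finally show ?thesis
    using D0 l unfolding l_def[symmetric] \<Delta>_def[symmetric] z_def[symmetric] D_def[symmetric] Z_def[symmetric]
    by (simp add: algebra_simps) (use mult_nonneg_nonneg[of D l] in linarith)
qed

text \<open>
  Without noise in row \<open>i\<close> the eigenvalue equation at \<open>i\<close> can be solved for \<open>y i\<close>. This delocalisation
  is what keeps the change of the column of \<open>i\<close> from dominating the perturbation.
\<close>
lemma aligned_eigenvector_noiseless_row:
  assumes I: "finite I" "S \<subseteq> I" "S \<noteq> {}" and a: "a > 0"
    and y: "aligned_eigenvector a S I W y \<mu>"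
    and i: "i \<in> I" and row: "\<And>j. j \<in> I \<Longrightarrow> W i j = 0"
  shows "\<bar>y i\<bar> \<le> 11 / 10 / sqrt (real (card S))"
proof -
  define k where "k = real (card S)"
  have k: "k > 0" using I by (simp add: k_def card_gt_0_iff finite_subset)
  have l: "a * k > 0" using a k by simp
  have "mat_apply I W y i = 0" using row by (simp add: mat_apply_def)
  hence eq: "\<mu> * y i = a * k * spike S i - (if i \<in> S then a * y i else 0)"
    using y i mat_apply_planted[OF I, of a W y i]
    by (simp add: aligned_eigenvector_def k_def residual_def)
  have \<mu>: "99 / 100 * (a * k) \<le> \<mu>" using y by (simp add: aligned_eigenvector_def k_def)
  show ?thesis
  proof (cases "i \<in> S")
    case True
    hence "(\<mu> + a) * y i = a * k * (1 / sqrt k)"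
      using eq by (simp add: spike_def k_def algebra_simps)
    moreover have "\<mu> + a > 0" using \<mu> l a by linarith
    ultimately have yi: "y i = a * k * (1 / sqrt k) / (\<mu> + a)"
      using nonzero_mult_div_cancel_left[of "\<mu> + a" "y i"] by simp
    have "0 \<le> y i"
      unfolding yi using l k \<open>\<mu> + a > 0\<close> by auto
    moreover have "a * k \<le> 11 / 10 * (\<mu> + a)" using \<mu> l a by (simp add: field_simps)
    hence "a * k / (\<mu> + a) \<le> 11 / 10"
      using \<open>\<mu> + a > 0\<close> by (simp add: pos_divide_le_eq)
    hence "a * k / (\<mu> + a) * (1 / sqrt k) \<le> 11 / 10 * (1 / sqrt k)"
      using k by (intro mult_right_mono) auto
    hence "y i \<le> 11 / 10 / sqrt k" unfolding yi by (simp add: mult.commute)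
    ultimately show ?thesis by (simp add: k_def)
  next
    case False
    moreover have "\<mu> > 0" using \<mu> l by linarith
    ultimately have "y i = 0" using eq by (simp add: spike_def)
    thus ?thesis using k by (simp add: k_def)
  qed
qed

text \<open>
  Here \<open>W'\<close> is \<open>W\<close> without the influence of \<open>i\<close>. Removing \<open>i\<close> changes row and column \<open>i\<close>, and also
  other entries, by \<open>Z\<close>. Accordingly \<open>(W - W') y'\<close> consists of the single entry
  \<open>(W y') i\<close>, of column \<open>i\<close> weighted by the small number \<open>y' i\<close>, and of \<open>Z y'\<close>; each has norm of order at
  most \<open>a * card S / sqrt (card S)\<close>. By the perturbation bound \<open>y - y'\<close> is then so small that \<open>W\<close>,
  whose norm is at most a hundredth of the signal, cannot move entry \<open>i\<close> by much.
\<close>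
lemma leave_one_out_entry_bound:
  assumes I: "finite I" "S \<subseteq> I" "S \<noteq> {}" and a: "a > 0"
    and W: "op_bounded I W \<rho>" and small: "a + \<rho> \<le> a * real (card S) / 100"
    and \<rho>: "\<rho> \<ge> 0"
    and y: "aligned_eigenvector a S I W y \<mu>" and y': "aligned_eigenvector a S I W' y' \<mu>'"
    and i: "i \<in> I" and row: "\<And>j. j \<in> I \<Longrightarrow> W' i j = 0"
    and dec: "\<And>l j. l \<in> I \<Longrightarrow> j \<in> I \<Longrightarrow>
      W l j = W' l j + (if l = i then W i j else 0) + (if j = i then W l i else 0) + Z l j"
    and Z: "op_bounded I Z \<zeta>" and \<zeta>: "0 \<le> \<zeta>" "\<zeta> \<le> a * real (card S) / sqrt (real (card S))"
    and \<tau>: "\<bar>mat_apply I W y' i\<bar> \<le> \<tau>" "\<tau> \<le> a * real (card S) / sqrt (real (card S)) / 9"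
  shows "\<bar>mat_apply I W y i\<bar> \<le> a * real (card S) / sqrt (real (card S)) / 4"
proof -
  define k where "k = real (card S)"
  define l where "l = a * k"
  define s where "s = l / sqrt k"
  define \<Delta> where "\<Delta> = (\<lambda>i. y i - y' i)"
  define z where "z = (\<lambda>i. mat_apply I W y' i - mat_apply I W' y' i)"
  have k: "k > 0" using I by (simp add: k_def card_gt_0_iff finite_subset)
  have l: "l > 0" using a k by (simp add: l_def)
  have s: "s > 0" using l k by (simp add: s_def)
  have \<rho>l: "\<rho> \<le> l / 100" using small a by (simp add: l_def k_def)
  have \<tau>0: "\<tau> \<ge> 0" using \<tau>(1) by linarith
  have z: "z j = (if j = i then mat_apply I W y' i else 0) + y' i * W j i + mat_apply I Z y' j" if "j \<in> I" for j
  proof -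
    have "z j = (\<Sum>m\<in>I. (W j m - W' j m) * y' m)"
      by (simp add: z_def mat_apply_def sum_subtractf left_diff_distrib)
    also have "\<dots> = (\<Sum>m\<in>I. (if j = i then W i m * y' m else 0) +
        ((if m = i then W j i * y' m else 0) + Z j m * y' m))"
    proof (rule sum.cong[OF refl])
      fix m assume "m \<in> I"
      show "(W j m - W' j m) * y' m = (if j = i then W i m * y' m else 0) +
        ((if m = i then W j i * y' m else 0) + Z j m * y' m)"
        using dec[OF that \<open>m \<in> I\<close>] by (auto simp: algebra_simps split: if_splits)
    qed
    also have "\<dots> = (if j = i then mat_apply I W y' i else 0) + y' i * W j i + mat_apply I Z y' j"
      using i I(1) by (simp add: sum.distrib mat_apply_def)
    finally show ?thesis .
  qed
  \<comment> \<open>Column \<open>i\<close> is the image of the \<open>i\<close>-th unit vector.\<close>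
  have single: "L2_set (\<lambda>j. if j = i then c else 0) I = \<bar>c\<bar>" for c :: real
    using i I(1) by (simp add: L2_set_def if_distrib[of power2] cong: if_cong)
  have "L2_set (\<lambda>j. W j i) I = L2_set (mat_apply I W (\<lambda>j. if j = i then 1 else 0)) I"
    using i I(1) by (intro L2_set_cong) (simp_all add: mat_apply_def if_distrib cong: if_cong)
  also have "\<dots> \<le> \<rho>"
    using op_boundedD[OF W, of "\<lambda>j. if j = i then 1 else 0"] by (simp add: single)
  finally have col: "L2_set (\<lambda>j. W j i) I \<le> \<rho>" .
  have "L2_set z I = L2_set (\<lambda>j. (if j = i then mat_apply I W y' i else 0) + y' i * W j i + mat_apply I Z y' j) I"
    using z by (intro L2_set_cong) auto
  also have "\<dots> \<le> L2_set (\<lambda>j. if j = i then mat_apply I W y' i else 0) I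
      + L2_set (\<lambda>j. y' i * W j i) I + L2_set (mat_apply I Z y') I"
    using L2_set_triangle_ineq[of "\<lambda>j. (if j = i then mat_apply I W y' i else 0) + y' i * W j i" "mat_apply I Z y'" I]
      L2_set_triangle_ineq[of "\<lambda>j. if j = i then mat_apply I W y' i else 0" "\<lambda>j. y' i * W j i" I]
    by linarith
  also have "\<dots> \<le> \<tau> + 11 / 10 / sqrt k * (l / 100) + s * (11 / 10)"
  proof (intro add_mono)
    show "L2_set (\<lambda>j. if j = i then mat_apply I W y' i else 0) I \<le> \<tau>"
      using \<tau> by (simp add: single)
    have "\<bar>y' i\<bar> \<le> 11 / 10 / sqrt k"
      using aligned_eigenvector_noiseless_row[OF I a y' i row] by (simp add: k_def)
    thus "L2_set (\<lambda>j. y' i * W j i) I \<le> 11 / 10 / sqrt k * (l / 100)"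
      unfolding L2_set_scale using col \<rho>l k by (intro mult_mono) auto
    have "L2_set (mat_apply I Z y') I \<le> \<zeta> * L2_set y' I"
      by (rule op_boundedD[OF Z])
    also have "\<dots> \<le> s * (11 / 10)"
      using \<zeta> y' s by (intro mult_mono) (auto simp: s_def l_def k_def aligned_eigenvector_def)
    finally show "L2_set (mat_apply I Z y') I \<le> s * (11 / 10)" .
  qed
  also have "11 / 10 / sqrt k * (l / 100) = s * (11 / 1000)"
    by (simp add: s_def)
  also have "\<tau> + s * (11 / 1000) + s * (11 / 10) \<le> 5 / 4 * s"
    using \<tau>(2) s by (simp add: s_def l_def k_def)
  finally have nz: "L2_set z I \<le> 5 / 4 * s" .
  have "l * L2_set \<Delta> I \<le> 3 * L2_set z I"
    using aligned_eigenvector_perturbation[OF I a W small y y']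
    by (simp add: l_def k_def z_def \<Delta>_def)
  hence D: "l * L2_set \<Delta> I \<le> 15 / 4 * s" using nz by linarith
  have "\<bar>mat_apply I W \<Delta> i\<bar> \<le> L2_set (mat_apply I W \<Delta>) I"
    using member_le_L2_set[OF I(1) i, of "\<lambda>j. \<bar>mat_apply I W \<Delta> j\<bar>"] by (simp add: L2_set_def)
  also have "\<dots> \<le> \<rho> * L2_set \<Delta> I" by (rule op_boundedD[OF W])
  also have "\<dots> \<le> l / 100 * L2_set \<Delta> I" using \<rho>l by (intro mult_right_mono) auto
  also have "\<dots> \<le> s / 9" using D s by simp
  finally have "\<bar>mat_apply I W \<Delta> i\<bar> \<le> s / 9" .
  moreover have "mat_apply I W y i = mat_apply I W y' i + mat_apply I W \<Delta> i"
    by (simp add: \<Delta>_def mat_apply_diff)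
  moreover have "\<tau> \<le> s / 9" using \<tau>(2) by (simp add: s_def l_def k_def)
  ultimately have "\<bar>mat_apply I W y i\<bar> \<le> s / 4" using \<tau>(1) s by linarith
  thus ?thesis by (simp add: s_def l_def k_def)
qed

text \<open>
  The eigenvalue equation gives \<open>\<mu> * y j = (W y) j\<close> outside \<open>S\<close> and
  \<open>(\<mu> + a) * y i = a * card S / sqrt (card S) + (W y) i\<close> on \<open>S\<close>. As \<open>a\<close> is small against \<open>\<mu>\<close> and the noise is at
  most a quarter of the signal, the threshold \<open>1 / (2 * sqrt (card S))\<close> separates the entries.
\<close>
lemma aligned_eigenvector_separates:
  assumes I: "finite I" "S \<subseteq> I" "S \<noteq> {}" and a: "a > 0"
    and k: "card S \<ge> 100"
    and y: "aligned_eigenvector a S I W y \<mu>"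
    and noise: "\<And>i. i \<in> I \<Longrightarrow> \<bar>mat_apply I W y i\<bar> \<le> a * real (card S) / sqrt (real (card S)) / 4"
    and i: "i \<in> S" and j: "j \<in> I - S"
  shows "\<bar>y j\<bar> < \<bar>y i\<bar>"
proof -
  define k where "k = real (card S)"
  define l where "l = a * k"
  define s where "s = 1 / sqrt k"
  have k: "k \<ge> 100" using assms by (simp add: k_def)
  have l: "l > 0" using a k by (simp add: l_def)
  have s: "s > 0" using k by (simp add: s_def)
  have al: "a \<le> l / 100" using a k mult_left_mono[of 100 k a] by (simp add: l_def)
  have \<mu>: "99 / 100 * l \<le> \<mu>" "\<mu> \<le> 101 / 100 * l"
    using y by (simp_all add: aligned_eigenvector_def l_def k_def)
  have ev: "\<mu> * y m = l * spike S m + residual a S I W y m" if "m \<in> I" for m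
    using y that mat_apply_planted[OF I, of a W y m] by (simp add: aligned_eigenvector_def l_def k_def)
  have noise': "\<bar>mat_apply I W y m\<bar> \<le> l * s / 4" if "m \<in> I" for m
    using noise[OF that] by (simp add: l_def k_def s_def)
  have ls: "l * s > 0" using l s by simp
  have "\<mu> * \<bar>y j\<bar> = \<bar>\<mu> * y j\<bar>" using \<mu> l by (simp add: abs_mult)
  also have "\<dots> \<le> l * s / 4"
    using ev[of j] noise'[of j] j by (simp add: residual_def spike_def)
  finally have "99 / 100 * l * \<bar>y j\<bar> \<le> l * s / 4"
    using mult_right_mono[OF \<mu>(1), of "\<bar>y j\<bar>"] by linarith
  hence "l * \<bar>y j\<bar> < l * (s / 2)" using ls by simp
  hence yj: "\<bar>y j\<bar> < s / 2" using l by simp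
  have iI: "i \<in> I" using i I by auto
  have "(\<mu> + a) * y i = l * s + mat_apply I W y i"
    using ev[OF iI] i by (simp add: residual_def spike_def s_def k_def algebra_simps)
  hence "l * s * (3 / 4) \<le> (\<mu> + a) * y i" using noise'[OF iI] by linarith
  also have "\<dots> \<le> (\<mu> + a) * \<bar>y i\<bar>" using \<mu> l a by (intro mult_left_mono) auto
  also have "\<dots> \<le> (102 / 100 * l) * \<bar>y i\<bar>" using \<mu> al by (intro mult_right_mono) auto
  finally have "l * (s / 2) < l * \<bar>y i\<bar>" using ls by simp
  hence "s / 2 < \<bar>y i\<bar>" using l by simp
  with yj show ?thesis by linarith
qed

section \<open>Noise of the hypergraph and its leave-one-out decomposition\<close>

lemma card_supersets_of_card:
  assumes "finite A" "T \<subseteq> A" "card T \<le> d"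
  shows "card {e. T \<subseteq> e \<and> e \<subseteq> A \<and> card e = d} = (card A - card T) choose (d - card T)"
proof -
  let ?B = "{e. e \<subseteq> A - T \<and> card e = d - card T}"
  have fT: "finite T" using assms by (blast intro: finite_subset)
  have "bij_betw (\<lambda>e. e - T) {e. T \<subseteq> e \<and> e \<subseteq> A \<and> card e = d} ?B"
  proof (rule bij_betwI[where g = "\<lambda>e. e \<union> T"])
    show "(\<lambda>e. e - T) \<in> {e. T \<subseteq> e \<and> e \<subseteq> A \<and> card e = d} \<rightarrow> ?B"
      using fT by (auto simp: card_Diff_subset)
    show "(\<lambda>e. e \<union> T) \<in> ?B \<rightarrow> {e. T \<subseteq> e \<and> e \<subseteq> A \<and> card e = d}"
    proof
      fix e assume e: "e \<in> ?B"
      hence "finite e" using assms(1) by (blast intro: finite_subset)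
      hence "card (e \<union> T) = card e + card T"
        using e fT by (intro card_Un_disjoint) auto
      thus "e \<union> T \<in> {e. T \<subseteq> e \<and> e \<subseteq> A \<and> card e = d}"
        using e assms by auto
    qed
  qed auto
  hence "card {e. T \<subseteq> e \<and> e \<subseteq> A \<and> card e = d} = card ?B"
    by (rule bij_betw_same_card)
  also have "\<dots> = card (A - T) choose (d - card T)"
    using assms(1) by (intro n_subsets) simp
  also have "card (A - T) = card A - card T"
    using fT assms(2) by (rule card_Diff_subset)
  finally show ?thesis .
qed

lemma card_hyperedges_containing_le:
  assumes "card T \<le> d" and "finite T"
  shows "card {e \<in> hyperedges n d. T \<subseteq> e} \<le> n ^ (d - card T)"
proof (cases "T \<subseteq> {0..<n}")
  case True
  have "{e \<in> hyperedges n d. T \<subseteq> e} = {e. T \<subseteq> e \<and> e \<subseteq> {0..<n} \<and> card e = d}"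
    by (auto simp: hyperedges_def)
  hence "card {e \<in> hyperedges n d. T \<subseteq> e} = (n - card T) choose (d - card T)"
    using card_supersets_of_card[OF _ True assms(1)] by simp
  also have "\<dots> \<le> (n - card T) ^ (d - card T)"
    by (cases "d - card T \<le> n - card T") (simp_all add: binomial_le_pow binomial_eq_0)
  also have "\<dots> \<le> n ^ (d - card T)"
    by (intro power_mono) auto
  finally show ?thesis .
next
  case False
  hence "{e \<in> hyperedges n d. T \<subseteq> e} = {}" by (auto simp: hyperedges_def)
  thus ?thesis by (simp only: card.empty)
qed

definition edge_prob :: "real \<Rightarrow> nat set \<Rightarrow> nat set \<Rightarrow> real" where
  "edge_prob p S e = (if e \<subseteq> S then 1 else p)"

abbreviation noise :: "nat \<Rightarrow> nat \<Rightarrow> real \<Rightarrow> nat set \<Rightarrow> (nat set \<Rightarrow> bool) \<Rightarrow> nat \<Rightarrow> nat \<Rightarrow> real" where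
  "noise n d p S H \<equiv> codegree_matrix (hyperedges n d) (\<lambda>e. e) (centred (edge_prob p S) H)"

abbreviation noise_avoiding ::
    "nat \<Rightarrow> nat \<Rightarrow> real \<Rightarrow> nat set \<Rightarrow> nat \<Rightarrow> (nat set \<Rightarrow> bool) \<Rightarrow> nat \<Rightarrow> nat \<Rightarrow> real" where
  "noise_avoiding n d p S i H \<equiv>
     codegree_matrix {e \<in> hyperedges n d. i \<notin> e} (\<lambda>e. e) (centred (edge_prob p S) H)"

abbreviation noise_link ::
    "nat \<Rightarrow> nat \<Rightarrow> real \<Rightarrow> nat set \<Rightarrow> nat \<Rightarrow> (nat set \<Rightarrow> bool) \<Rightarrow> nat \<Rightarrow> nat \<Rightarrow> real" where
  "noise_link n d p S i H \<equiv>
     codegree_matrix {e \<in> hyperedges n d. i \<in> e} (\<lambda>e. e - {i}) (centred (edge_prob p S) H)"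

text \<open>
  An edge through \<open>i\<close> also contributes to the entries of its other vertex pairs. For these pairs it
  acts as an edge of the link of \<open>i\<close>, a hypergraph of one uniformity less, whose norm is smaller by a
  factor of order \<open>sqrt n\<close>.
\<close>
lemma noise_decomposition:
  "noise n d p S H l j = noise_avoiding n d p S i H l j
     + (if l = i then noise n d p S H i j else 0) + (if j = i then noise n d p S H l i else 0)
     + noise_link n d p S i H l j"
proof (cases "l = j \<or> l = i \<or> j = i")
  case True
  thus ?thesis
    by (auto simp: codegree_matrix_def intro!: sum.neutral)
next
  case False
  let ?E = "{e \<in> hyperedges n d. {l, j} \<subseteq> e}"
  let ?X = "centred (edge_prob p S) H"
  have "sum ?X ?E = sum ?X ({e \<in> ?E. i \<notin> e} \<union> {e \<in> ?E. i \<in> e})"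
    by (rule arg_cong[of _ _ "sum ?X"]) auto
  also have "\<dots> = sum ?X {e \<in> ?E. i \<notin> e} + sum ?X {e \<in> ?E. i \<in> e}"
    using finite_hyperedges[of n d] by (intro sum.union_disjoint) auto
  also have "{e \<in> ?E. i \<notin> e} = {e. e \<in> {e \<in> hyperedges n d. i \<notin> e} \<and> {l, j} \<subseteq> e}" by auto
  also have "{e \<in> ?E. i \<in> e} = {e. e \<in> {e \<in> hyperedges n d. i \<in> e} \<and> {l, j} \<subseteq> e - {i}}"
    using False by auto
  finally show ?thesis using False by (simp add: codegree_matrix_def)
qed

definition top_eigenvector_of :: "'a set \<Rightarrow> ('a \<Rightarrow> 'a \<Rightarrow> real) \<Rightarrow> ('a \<Rightarrow> real) \<Rightarrow> real \<Rightarrow> bool" where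
  "top_eigenvector_of I M u \<mu> \<longleftrightarrow> dotp I u u = 1 \<and> (\<forall>i\<in>I. mat_apply I M u i = \<mu> * u i) \<and>
     (\<forall>y. dotp I y (mat_apply I M y) \<le> \<mu> * dotp I y y)"

text \<open>
  A fixed choice makes the vector a function of the matrix, so that it inherits independence from
  the edges that do not enter the matrix.
\<close>
definition some_top_eigenvector :: "'a set \<Rightarrow> ('a \<Rightarrow> 'a \<Rightarrow> real) \<Rightarrow> 'a \<Rightarrow> real" where
  "some_top_eigenvector I M = (SOME u. \<exists>\<mu>. top_eigenvector_of I M u \<mu>)"

lemma some_top_eigenvector:
  assumes "finite I" "I \<noteq> {}" "sym_matrix I M"
  obtains \<mu> where "top_eigenvector_of I M (some_top_eigenvector I M) \<mu>"
proof -
  have "\<exists>u \<mu>. top_eigenvector_of I M u \<mu>"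
    using top_eigenvector_exists[OF assms] unfolding top_eigenvector_of_def by metis
  hence "\<exists>\<mu>. top_eigenvector_of I M (some_top_eigenvector I M) \<mu>"
    unfolding some_top_eigenvector_def by (rule someI_ex)
  thus thesis using that by blast
qed

lemma sym_planted: "sym_matrix I W \<Longrightarrow> sym_matrix I (planted a S W)"
  by (auto simp: sym_matrix_def planted_def)

abbreviation leave_one_out_vector ::
    "nat \<Rightarrow> nat \<Rightarrow> real \<Rightarrow> real \<Rightarrow> nat set \<Rightarrow> nat \<Rightarrow> (nat set \<Rightarrow> bool) \<Rightarrow> nat \<Rightarrow> real" where
  "leave_one_out_vector n d p a S i H \<equiv> some_top_eigenvector {0..<n} (planted a S (noise_avoiding n d p S i H))"

text \<open>
  The deterministic core of the argument. Both top eigenvectors, with and without the noise of the edges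
  through a vertex \<open>m\<close>, are aligned with the clique, and the leave-one-out bound at \<open>m\<close> controls the noise in
  coordinate \<open>m\<close>. Each vertex is left out in turn, always for the sake of its own coordinate.
\<close>
lemma clique_entries_dominate:
  assumes S: "S \<subseteq> {0..<n}" "card S \<ge> 100" and a: "a > 0"
    and W: "op_bounded {0..<n} (noise n d p S H) \<rho>"
    and W': "\<And>i. i < n \<Longrightarrow> op_bounded {0..<n} (noise_avoiding n d p S i H) \<rho>"
    and Z: "\<And>i. i < n \<Longrightarrow> op_bounded {0..<n} (noise_link n d p S i H) \<zeta>"
    and row: "\<And>i. i < n \<Longrightarrow>
      \<bar>mat_apply {0..<n} (noise n d p S H) (leave_one_out_vector n d p a S i H) i\<bar> \<le> t"
    and nonneg: "0 \<le> \<rho>" "0 \<le> \<zeta>"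
    and \<rho>: "a + \<rho> \<le> a * real (card S) / 100"
    and \<zeta>: "\<zeta> \<le> a * real (card S) / sqrt (real (card S))"
    and t: "t \<le> a * real (card S) / sqrt (real (card S)) / 10"
    and u: "top_eigenvector_of {0..<n} (planted a S (noise n d p S H)) u \<mu>"
    and i: "i \<in> S" and j: "j \<in> {0..<n} - S"
  shows "\<bar>u j\<bar> < \<bar>u i\<bar>"
proof -
  let ?I = "{0..<n}" and ?W = "noise n d p S H"
  have ne: "S \<noteq> {}" using i by auto
  have I: "finite ?I" "S \<subseteq> ?I" "S \<noteq> {}" "?I \<noteq> {}" using S ne by auto
  define c where "c = dotp ?I (spike S) u"
  define y where "y = (\<lambda>i. 1 / c * u i)"
  have c: "c \<noteq> 0" and y: "aligned_eigenvector a S ?I ?W y \<mu>"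
    using top_eigenvector_aligned[OF I(1-3) a W \<rho>, of u \<mu>] u
    unfolding y_def c_def top_eigenvector_of_def by blast+
  have entry: "\<bar>mat_apply ?I ?W y m\<bar> \<le> a * real (card S) / sqrt (real (card S)) / 4" if m: "m \<in> ?I" for m
  proof -
    have mn: "m < n" using m by simp
    let ?W' = "noise_avoiding n d p S m H"
    define u' where "u' = leave_one_out_vector n d p a S m H"
    obtain \<mu>' where u': "top_eigenvector_of ?I (planted a S ?W') u' \<mu>'"
      using some_top_eigenvector[OF I(1,4) sym_planted[OF sym_codegree_matrix]] unfolding u'_def by blast
    define c' where "c' = dotp ?I (spike S) u'"
    define y' where "y' = (\<lambda>i. 1 / c' * u' i)"
    have c': "\<bar>1 / c'\<bar> \<le> 11 / 10" and y': "aligned_eigenvector a S ?I ?W' y' \<mu>'"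
      using top_eigenvector_aligned[OF I(1-3) a W'[OF mn] \<rho>, of u' \<mu>'] u'
      unfolding y'_def c'_def top_eigenvector_of_def by blast+
    have "\<bar>mat_apply ?I ?W y' m\<bar> = \<bar>1 / c'\<bar> * \<bar>mat_apply ?I ?W u' m\<bar>"
      unfolding y'_def mat_apply_scale abs_mult ..
    also have "\<dots> \<le> 11 / 10 * t"
      using c' row[OF mn] by (intro mult_mono) (auto simp: u'_def)
    finally have \<tau>: "\<bar>mat_apply ?I ?W y' m\<bar> \<le> 11 / 10 * t" .
    define X where "X = a * real (card S) / sqrt (real (card S))"
    have "t \<le> X / 10" "0 \<le> X" using t a by (simp_all add: X_def)
    hence "11 / 10 * t \<le> X / 9" by simp
    hence \<tau>': "11 / 10 * t \<le> a * real (card S) / sqrt (real (card S)) / 9" by (simp only: X_def)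
    have zero_row: "?W' m j = 0" for j
      by (auto simp: codegree_matrix_def intro!: sum.neutral)
    show ?thesis
      using leave_one_out_entry_bound[OF I(1-3) a W \<rho> nonneg(1) y y' m zero_row noise_decomposition
          Z[OF mn] nonneg(2) \<zeta> \<tau> \<tau>'] .
  qed
  have "\<bar>y j\<bar> < \<bar>y i\<bar>"
    using aligned_eigenvector_separates[OF I(1-3) a S(2) y entry i j] .
  thus ?thesis
    using c by (simp add: y_def abs_mult divide_strict_right_mono field_simps)
qed

lemma mat_apply_noise_row:
  assumes "i < n"
  shows "mat_apply {0..<n} (noise n d p S H) x i =
    (\<Sum>e | e \<in> hyperedges n d \<and> i \<in> e. (\<Sum>j\<in>e - {i}. x j) * centred (edge_prob p S) H e)"
proof -
  let ?I = "{0..<n}" and ?E = "{e. e \<in> hyperedges n d \<and> i \<in> e}"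
  let ?X = "centred (edge_prob p S) H"
  have "noise n d p S H i j = (\<Sum>e\<in>?E. (if j \<in> e - {i} then ?X e else 0))" for j
    unfolding codegree_matrix_def using finite_hyperedges[of n d]
    by (auto intro!: sum.mono_neutral_cong_left split: if_splits)
  hence "mat_apply ?I (noise n d p S H) x i = (\<Sum>j\<in>?I. \<Sum>e\<in>?E. (if j \<in> e - {i} then x j else 0) * ?X e)"
    unfolding mat_apply_def by (auto simp: sum_distrib_right intro!: sum.cong)
  also have "\<dots> = (\<Sum>e\<in>?E. (\<Sum>j\<in>?I. if j \<in> e - {i} then x j else 0) * ?X e)"
    by (subst sum.swap) (simp add: sum_distrib_right)
  also have "\<dots> = (\<Sum>e\<in>?E. (\<Sum>j\<in>e - {i}. x j) * ?X e)"
  proof (rule sum.cong[OF refl])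
    fix e assume "e \<in> ?E"
    hence "e \<subseteq> ?I" by (auto simp: hyperedges_def)
    hence "(\<Sum>j\<in>?I. if j \<in> e - {i} then x j else 0) = (\<Sum>j\<in>e - {i}. x j)"
      by (intro sum.mono_neutral_cong_right) auto
    thus "(\<Sum>j\<in>?I. if j \<in> e - {i} then x j else 0) * ?X e = (\<Sum>j\<in>e - {i}. x j) * ?X e"
      by simp
  qed
  finally show ?thesis .
qed

lemma sum_link_squares_le:
  assumes "i < n" and d: "d \<ge> 2"
  shows "(\<Sum>e | e \<in> hyperedges n d \<and> i \<in> e. (\<Sum>j\<in>e - {i}. x j)\<^sup>2)
    \<le> real d * real (n ^ (d - 2)) * dotp {0..<n} x x"
proof -
  let ?I = "{0..<n}" and ?E = "{e. e \<in> hyperedges n d \<and> i \<in> e}"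
  have fE: "finite ?E" using finite_hyperedges[of n d] by simp
  have "(\<Sum>e\<in>?E. (\<Sum>j\<in>e - {i}. x j)\<^sup>2) \<le> (\<Sum>e\<in>?E. real d * (\<Sum>j\<in>?I. (if j \<in> e - {i} then (x j)\<^sup>2 else 0)))"
  proof (rule sum_mono)
    fix e assume e: "e \<in> ?E"
    hence s: "e \<subseteq> ?I" "card e = d" by (auto simp: hyperedges_def)
    have fe: "finite e" using s by (blast intro: finite_subset)
    have "(\<Sum>j\<in>e - {i}. 1 * x j)\<^sup>2 \<le> (\<Sum>j\<in>e - {i}. 1\<^sup>2) * (\<Sum>j\<in>e - {i}. (x j)\<^sup>2)"
      by (rule Cauchy_Schwarz_ineq_sum)
    also have "\<dots> \<le> real d * (\<Sum>j\<in>e - {i}. (x j)\<^sup>2)"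
      using s card_mono[OF fe, of "e - {i}"] by (intro mult_right_mono sum_nonneg) auto
    also have "(\<Sum>j\<in>e - {i}. (x j)\<^sup>2) = (\<Sum>j\<in>?I. (if j \<in> e - {i} then (x j)\<^sup>2 else 0))"
      using s by (intro sum.mono_neutral_cong_left) auto
    finally show "(\<Sum>j\<in>e - {i}. x j)\<^sup>2 \<le> real d * (\<Sum>j\<in>?I. (if j \<in> e - {i} then (x j)\<^sup>2 else 0))"
      by simp
  qed
  also have "\<dots> = real d * (\<Sum>j\<in>?I. \<Sum>e\<in>?E. if j \<in> e - {i} then (x j)\<^sup>2 else 0)"
    by (simp only: sum_distrib_left[symmetric] sum.swap[of _ ?I])
  also have "\<dots> \<le> real d * (\<Sum>j\<in>?I. real (n ^ (d - 2)) * (x j)\<^sup>2)"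
  proof (intro mult_left_mono sum_mono)
    fix j assume "j \<in> ?I"
    show "(\<Sum>e\<in>?E. if j \<in> e - {i} then (x j)\<^sup>2 else 0) \<le> real (n ^ (d - 2)) * (x j)\<^sup>2"
    proof (cases "j = i")
      case False
      have "(\<Sum>e\<in>?E. if j \<in> e - {i} then (x j)\<^sup>2 else 0) =
          (\<Sum>e | e \<in> hyperedges n d \<and> {i, j} \<subseteq> e. (x j)\<^sup>2)"
        using fE False by (intro sum.mono_neutral_cong_right) auto
      also have "\<dots> \<le> real (n ^ (d - 2)) * (x j)\<^sup>2"
        using card_hyperedges_containing_le[of "{i, j}" d n] False d
        by (auto intro!: mult_right_mono simp: numeral_2_eq_2 simp flip: of_nat_power)
      finally show ?thesis .
    qed simp
  qed simp
  finally show ?thesis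
    by (simp add: dotp_def power2_eq_square sum_distrib_left mult_ac)
qed

lemma dotp_some_top_eigenvector:
  assumes "finite I" "I \<noteq> {}" "sym_matrix I M"
  shows "dotp I (some_top_eigenvector I M) (some_top_eigenvector I M) = 1"
  using some_top_eigenvector[OF assms] by (metis top_eigenvector_of_def)

lemma edge_prob_bounds: "0 \<le> p \<Longrightarrow> p \<le> 1 \<Longrightarrow> 0 \<le> edge_prob p S e \<and> edge_prob p S e \<le> 1"
  by (simp add: edge_prob_def)

text \<open>
  The leave-one-out vector is a function of the edges avoiding \<open>i\<close>, whereas row \<open>i\<close> of the noise
  consists of edges through \<open>i\<close>. Conditionally on the former, the entry is a sum of independent
  terms whose squared coefficients add up to at most \<open>d * n ^ (d - 2)\<close>.
\<close>
lemma leave_one_out_row_tail: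
  assumes i: "i < n" and d: "d \<ge> 2" and p: "0 \<le> p" "p \<le> 1" and t: "t \<ge> 0"
  shows "measure_pmf.prob (bernoulli_product (hyperedges n d) (edge_prob p S))
      {H. t < \<bar>mat_apply {0..<n} (noise n d p S H) (leave_one_out_vector n d p a S i H) i\<bar>}
    \<le> 2 * exp (- 2 * t\<^sup>2 / (real d * real (n ^ (d - 2))))"
proof -
  let ?E = "{e. e \<in> hyperedges n d \<and> i \<in> e}"
  define c where "c H e = (\<Sum>j\<in>e - {i}. leave_one_out_vector n d p a S i H j)" for H and e :: "nat set"
  have "noise_avoiding n d p S i (\<lambda>e. e \<notin> ?E \<and> H e) = noise_avoiding n d p S i H" for H
    by (auto simp: codegree_matrix_def centred_def fun_eq_iff intro!: sum.cong)
  hence c_restrict: "c (\<lambda>e. e \<notin> ?E \<and> H e) = c H" for H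
    unfolding c_def by simp
  have V: "(\<Sum>e\<in>?E. (c H e)\<^sup>2) \<le> real d * real (n ^ (d - 2))" for H
    using sum_link_squares_le[OF i d, of "leave_one_out_vector n d p a S i H"] i
      dotp_some_top_eigenvector[OF _ _ sym_planted[OF sym_codegree_matrix]]
    unfolding c_def by (simp add: dotp_some_top_eigenvector sym_planted sym_codegree_matrix)
  have "measure_pmf.prob (bernoulli_product (hyperedges n d) (edge_prob p S))
      {H. t < \<bar>\<Sum>e\<in>?E. c (\<lambda>e. e \<notin> ?E \<and> H e) e * centred (edge_prob p S) H e\<bar>}
    \<le> 2 * exp (- 2 * t\<^sup>2 / (real d * real (n ^ (d - 2))))"
    using p by (intro bernoulli_sum_tail_conditional V t finite_hyperedges edge_prob_bounds) auto
  thus ?thesis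
    unfolding c_restrict by (simp add: mat_apply_noise_row[OF i] c_def)
qed

lemma clique_entries_dominate_prob:
  fixes n d :: nat and p a :: real
  assumes d: "d \<ge> 3" and p: "0 \<le> p" "p \<le> 1" and a: "a > 0"
    and S: "S \<subseteq> {0..<n}" "card S \<ge> 100" and t: "t \<ge> 0"
  defines "\<rho> \<equiv> 8 * real d * sqrt (real (n ^ (d - 2)) * real n)"
    and "\<zeta> \<equiv> 8 * real d * sqrt (real (n ^ (d - 3)) * real n)"
  assumes \<rho>: "a + \<rho> \<le> a * real (card S) / 100"
    and \<zeta>: "\<zeta> \<le> a * real (card S) / sqrt (real (card S))"
    and t': "t \<le> a * real (card S) / sqrt (real (card S)) / 10"
  shows "measure_pmf.prob (bernoulli_product (hyperedges n d) (edge_prob p S))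
      {H. \<not> (\<forall>u \<mu>. top_eigenvector_of {0..<n} (planted a S (noise n d p S H)) u \<mu> \<longrightarrow>
             (\<forall>i\<in>S. \<forall>j\<in>{0..<n} - S. \<bar>u j\<bar> < \<bar>u i\<bar>))}
    \<le> 2 * exp (- real n) +
       real n * (4 * exp (- real n) + 2 * exp (- 2 * t\<^sup>2 / (real d * real (n ^ (d - 2)))))"
proof -
  let ?P = "bernoulli_product (hyperedges n d) (edge_prob p S)" and ?I = "{0..<n}"
  let ?b = "2 * exp (- 2 * t\<^sup>2 / (real d * real (n ^ (d - 2))))"
  have n: "n \<ge> 100" using card_mono[OF _ S(1)] S(2) by simp
  hence ne: "?I \<noteq> {}" by auto
  define B0 where "B0 = {H. \<not> op_bounded ?I (noise n d p S H) \<rho>}"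
  define B1 where "B1 i = {H. \<not> op_bounded ?I (noise_avoiding n d p S i H) \<rho>}" for i
  define B2 where "B2 i = {H. \<not> op_bounded ?I (noise_link n d p S i H) \<zeta>}" for i
  define B3 where "B3 i = {H. t < \<bar>mat_apply {0..<n} (noise n d p S H) (leave_one_out_vector n d p a S i H) i\<bar>}" for i
  have N2: "card {e \<in> E. {i, j} \<subseteq> e} \<le> n ^ (d - 2)"
    if "i \<noteq> j" "E \<subseteq> hyperedges n d" for i j E
  proof -
    have "card {e \<in> E. {i, j} \<subseteq> e} \<le> card {e \<in> hyperedges n d. {i, j} \<subseteq> e}"
      using that finite_hyperedges[of n d] by (intro card_mono) auto
    also have "\<dots> \<le> n ^ (d - 2)"
      using card_hyperedges_containing_le[of "{i, j}" d n] that d by (simp add: numeral_2_eq_2)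
    finally show ?thesis .
  qed
  have N3: "card {e \<in> {e \<in> hyperedges n d. m \<in> e}. {i, j} \<subseteq> e - {m}} \<le> n ^ (d - 3)"
    if "i \<noteq> j" for i j m
  proof (cases "m = i \<or> m = j")
    case False
    have "{e \<in> {e \<in> hyperedges n d. m \<in> e}. {i, j} \<subseteq> e - {m}} = {e \<in> hyperedges n d. {m, i, j} \<subseteq> e}"
      using False by auto
    moreover have "card {m, i, j} = 3" using False that by simp
    ultimately show ?thesis
      using card_hyperedges_containing_le[of "{m, i, j}" d n] d by simp
  qed (auto simp: card_eq_0_iff)
  have sub: "e \<subseteq> ?I \<and> card e \<le> d" if "e \<in> hyperedges n d" for e
    using that by (simp add: hyperedges_def)
  have sub_link: "e - {m} \<subseteq> ?I" if "e \<in> hyperedges n d" for e m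
    using sub[OF that] by blast
  have card_link: "card e - Suc 0 \<le> d" if "e \<in> hyperedges n d" for e
    using that by (simp add: hyperedges_def)
  have P0: "measure_pmf.prob ?P B0 \<le> 2 * exp (- real n)"
    unfolding B0_def \<rho>_def
    using codegree_matrix_norm_tail[of "hyperedges n d" "hyperedges n d" "edge_prob p S" ?I
        "\<lambda>e. e" d "n ^ (d - 2)"] finite_hyperedges edge_prob_bounds[OF p] ne sub N2 d n by simp
  have P1: "measure_pmf.prob ?P (B1 i) \<le> 2 * exp (- real n)" for i
    unfolding B1_def \<rho>_def
    using codegree_matrix_norm_tail[of "hyperedges n d" "{e \<in> hyperedges n d. i \<notin> e}" "edge_prob p S" ?I
        "\<lambda>e. e" d "n ^ (d - 2)"] finite_hyperedges edge_prob_bounds[OF p] ne sub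
      N2[of _ _ "{e \<in> hyperedges n d. i \<notin> e}"] d n by simp
  have P2: "measure_pmf.prob ?P (B2 i) \<le> 2 * exp (- real n)" for i
    unfolding B2_def \<zeta>_def
    using codegree_matrix_norm_tail[of "hyperedges n d" "{e \<in> hyperedges n d. i \<in> e}" "edge_prob p S" ?I
        "\<lambda>e. e - {i}" d "n ^ (d - 3)"] finite_hyperedges edge_prob_bounds[OF p] ne sub_link card_link N3[of _ _ i] d n
    by auto
  have P3: "measure_pmf.prob ?P (B3 i) \<le> ?b" if "i < n" for i
    unfolding B3_def using leave_one_out_row_tail[OF that _ p t] d by simp
  let ?Bad = "{H. \<not> (\<forall>u \<mu>. top_eigenvector_of {0..<n} (planted a S (noise n d p S H)) u \<mu> \<longrightarrow>
             (\<forall>i\<in>S. \<forall>j\<in>{0..<n} - S. \<bar>u j\<bar> < \<bar>u i\<bar>))}"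
  have nonneg: "0 \<le> \<rho>" "0 \<le> \<zeta>" by (simp_all add: \<rho>_def \<zeta>_def)
  have "?Bad \<subseteq> B0 \<union> (\<Union>i\<in>?I. B1 i \<union> B2 i \<union> B3 i)"
  proof
    fix H assume H: "H \<in> ?Bad"
    show "H \<in> B0 \<union> (\<Union>i\<in>?I. B1 i \<union> B2 i \<union> B3 i)"
    proof (rule ccontr)
      assume good: "H \<notin> B0 \<union> (\<Union>i\<in>?I. B1 i \<union> B2 i \<union> B3 i)"
      have "op_bounded ?I (noise n d p S H) \<rho>" using good by (simp add: B0_def)
      moreover have "op_bounded ?I (noise_avoiding n d p S i H) \<rho>" "op_bounded ?I (noise_link n d p S i H) \<zeta>"
          "\<bar>mat_apply {0..<n} (noise n d p S H) (leave_one_out_vector n d p a S i H) i\<bar> \<le> t" if "i < n" for i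
        using good that by (auto simp: B1_def B2_def B3_def not_less)
      ultimately have "\<bar>u j\<bar> < \<bar>u i\<bar>"
        if "top_eigenvector_of {0..<n} (planted a S (noise n d p S H)) u \<mu>" "i \<in> S" "j \<in> ?I - S"
        for u \<mu> i j
        using clique_entries_dominate[OF S a _ _ _ _ nonneg \<rho> \<zeta> t' that] by blast
      thus False using H by blast
    qed
  qed
  hence "measure_pmf.prob ?P ?Bad \<le> measure_pmf.prob ?P (B0 \<union> (\<Union>i\<in>?I. B1 i \<union> B2 i \<union> B3 i))"
    by (intro measure_pmf.finite_measure_mono) auto
  also have "\<dots> \<le> measure_pmf.prob ?P B0 + measure_pmf.prob ?P (\<Union>i\<in>?I. B1 i \<union> B2 i \<union> B3 i)"
    by (intro measure_Un_le) auto
  also have "measure_pmf.prob ?P (\<Union>i\<in>?I. B1 i \<union> B2 i \<union> B3 i) \<le>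
      (\<Sum>i\<in>?I. measure_pmf.prob ?P (B1 i \<union> B2 i \<union> B3 i))"
    by (intro measure_pmf.finite_measure_subadditive_finite) auto
  also have "\<dots> \<le> (\<Sum>i\<in>?I. 4 * exp (- real n) + ?b)"
  proof (rule sum_mono)
    fix i assume "i \<in> ?I"
    have "measure_pmf.prob ?P (B1 i \<union> B2 i \<union> B3 i) \<le>
        measure_pmf.prob ?P (B1 i) + measure_pmf.prob ?P (B2 i) + measure_pmf.prob ?P (B3 i)"
      using measure_Un_le[of "B1 i" "measure_pmf ?P" "B2 i"]
        measure_Un_le[of "B1 i \<union> B2 i" "measure_pmf ?P" "B3 i"] by simp
    also have "\<dots> \<le> 4 * exp (- real n) + ?b"
      using P1[of i] P2[of i] P3[of i] \<open>i \<in> ?I\<close> by simp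
    finally show "measure_pmf.prob ?P (B1 i \<union> B2 i \<union> B3 i) \<le> 4 * exp (- real n) + ?b" .
  qed
  finally show ?thesis using P0 by simp
qed

section \<open>Exact recovery from the top eigenvector\<close>

text \<open>
  Centring an edge inside \<open>S\<close> at the null mean \<open>p\<close> instead of at its true mean \<open>1\<close> leaves \<open>1 - p\<close>, and
  a pair in \<open>S\<close> lies in \<open>(card S - 2) choose (d - 2)\<close> edges inside \<open>S\<close>.
\<close>
lemma adjacency_minus_null_mean:
  assumes S: "S \<subseteq> {0..<n}" and d: "d \<ge> 2" and p: "0 \<le> p" "p \<le> 1" and ij: "i < n" "j < n"
  shows "(adjacency n d H - null_mean n d p) $$ (i, j) =
    planted ((1 - p) * real ((card S - 2) choose (d - 2))) S (noise n d p S H) i j"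
proof (cases "i = j")
  case True
  thus ?thesis using ij
    by (simp add: adjacency_def null_mean_eq[OF d p] planted_def codegree_matrix_def)
next
  case False
  let ?E = "{e. e \<in> hyperedges n d \<and> {i, j} \<subseteq> e}" and ?X = "centred (edge_prob p S) H"
  have fE: "finite ?E" using finite_hyperedges[of n d] by simp
  have cE: "card ?E = (n - 2) choose (d - 2)"
    by (rule card_hyperedges_containing[OF ij False d])
  have inS: "{e \<in> ?E. e \<subseteq> S} = {e. {i, j} \<subseteq> e \<and> e \<subseteq> S \<and> card e = d}"
    using S by (auto simp: hyperedges_def)
  have cS: "card {e \<in> ?E. e \<subseteq> S} = (if i \<in> S \<and> j \<in> S then (card S - 2) choose (d - 2) else 0)"
  proof (cases "i \<in> S \<and> j \<in> S")
    case True
    have "card {i, j} = 2" using False by simp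
    thus ?thesis
      unfolding inS using True card_supersets_of_card[of S "{i, j}" d] finite_subset[OF S] d by simp
  next
    case False
    hence "{e \<in> ?E. e \<subseteq> S} = {}" by auto
    thus ?thesis using False by (simp only: card.empty if_False)
  qed
  have "(\<Sum>e\<in>?E. of_bool (H e)) - real (card ?E) * p = (\<Sum>e\<in>?E. of_bool (H e) - p)"
    by (simp add: sum_subtractf)
  also have "\<dots> = (\<Sum>e\<in>?E. ?X e + (if e \<subseteq> S then 1 - p else 0))"
    by (intro sum.cong) (auto simp: centred_def edge_prob_def)
  also have "\<dots> = sum ?X ?E + (1 - p) * real (card {e \<in> ?E. e \<subseteq> S})"
    using fE by (simp add: sum.distrib sum.If_cases Int_def)
  finally show ?thesis
    using False ij
    by (simp only: cE cS) (auto simp: adjacency_def null_mean_eq[OF d p] planted_def codegree_matrix_def)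
qed

text \<open>
  Being the largest among the eigenvalues is stronger than it looks: the maximum of the quadratic form
  is itself an eigenvalue, so the given one bounds the form.
\<close>
lemma unit_top_eigenvector_imp_top_eigenvector_of:
  assumes B: "dim_row B = n" "dim_col B = n" and n: "n > 0"
    and M: "\<And>i j. i < n \<Longrightarrow> j < n \<Longrightarrow> B $$ (i, j) = M i j" and sym: "sym_matrix {0..<n} M"
    and u: "unit_top_eigenvector B u"
  shows "dim_vec u = n" and "\<exists>\<mu>. top_eigenvector_of {0..<n} M (vec_index u) \<mu>"
proof -
  let ?I = "{0..<n}"
  obtain l where l: "eigenvector B u l" and lmax: "\<And>m. eigenvalue B m \<Longrightarrow> m \<le> l"
    and u1: "scalar_prod u u = 1"
    using u unfolding unit_top_eigenvector_def by blast
  show dim: "dim_vec u = n" using l B unfolding eigenvector_def by auto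
  have mult: "vec_index (B *\<^sub>v x) i = mat_apply ?I M (vec_index x) i" if "i < n" "dim_vec x = n" for x i
    using that B M by (simp add: mat_apply_def scalar_prod_def)
  have "mat_apply ?I M (vec_index u) i = l * vec_index u i" if "i \<in> ?I" for i
    using that l dim mult[of i u] by (simp add: eigenvector_def)
  moreover have "dotp ?I (vec_index u) (vec_index u) = 1"
    using u1 dim by (simp add: scalar_prod_def dotp_def)
  moreover have "dotp ?I y (mat_apply ?I M y) \<le> l * dotp ?I y y" for y
  proof -
    obtain x m where x: "dotp ?I x x = 1" "\<And>i. i \<in> ?I \<Longrightarrow> mat_apply ?I M x i = m * x i"
      and max: "\<And>y. dotp ?I y (mat_apply ?I M y) \<le> m * dotp ?I y y"
      using top_eigenvector_exists[OF _ _ sym] n by auto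
    define w where "w = Matrix.vec n x"
    have "B *\<^sub>v w = m \<cdot>\<^sub>v w"
    proof (rule Matrix.eq_vecI)
      fix i assume "i < dim_vec (m \<cdot>\<^sub>v w)"
      hence i: "i < n" by (simp add: w_def)
      have "mat_apply ?I M (vec_index w) i = mat_apply ?I M x i"
        by (intro mat_apply_cong) (simp add: w_def)
      thus "vec_index (B *\<^sub>v w) i = vec_index (m \<cdot>\<^sub>v w) i"
        using i x(2) mult[of i w] by (simp add: w_def)
    qed (simp add: w_def B)
    moreover have "w \<noteq> 0\<^sub>v n"
    proof
      assume "w = 0\<^sub>v n"
      hence "\<forall>i\<in>?I. x i = 0" by (metis atLeastLessThan_iff index_vec index_zero_vec(1) w_def)
      thus False using x(1) by (simp add: dotp_def)
    qed
    moreover have "w \<in> carrier_vec n" by (simp add: w_def)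
    ultimately have "eigenvalue B m"
      unfolding eigenvalue_def eigenvector_def B by blast
    hence "m * dotp ?I y y \<le> l * dotp ?I y y"
      using lmax by (intro mult_right_mono) (auto simp: dotp_self)
    thus ?thesis using max[of y] by linarith
  qed
  ultimately show "\<exists>\<mu>. top_eigenvector_of ?I M (vec_index u) \<mu>"
    unfolding top_eigenvector_of_def by blast
qed

lemma top_abs_entries_unique:
  assumes T: "top_abs_entries k u T" and S: "S \<subseteq> {0..<dim_vec u}" "card S = k"
    and dom: "\<And>i j. i \<in> S \<Longrightarrow> j \<in> {0..<dim_vec u} - S \<Longrightarrow> \<bar>vec_index u j\<bar> < \<bar>vec_index u i\<bar>"
  shows "T = S"
proof (rule ccontr)
  assume ne: "T \<noteq> S"
  have T': "T \<subseteq> {0..<dim_vec u}" "card T = k" using T by (auto simp: top_abs_entries_def)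
  have fin: "finite S" "finite T" using S T' by (auto intro: finite_subset)
  obtain i where i: "i \<in> S" "i \<notin> T"
    using card_subset_eq[OF fin(2), of S] ne S T' by auto
  obtain j where j: "j \<in> T" "j \<notin> S"
    using card_subset_eq[OF fin(1), of T] ne S T' by auto
  have "\<bar>vec_index u i\<bar> \<le> \<bar>vec_index u j\<bar>"
    using T i j S by (auto simp: top_abs_entries_def)
  thus False using dom[of i j] i j T' by force
qed

text \<open>
  Quantifying over all admissible eigenvectors and all resolutions of ties makes failure an event of
  the law of \<open>(A, S)\<close> alone, whatever rule produces the eigenvector and the estimate.
\<close>
definition spectral_failure :: "nat \<Rightarrow> nat \<Rightarrow> nat \<Rightarrow> real \<Rightarrow> (real mat \<times> nat set) set" where
  "spectral_failure n d k p = {(A, S). \<exists>u T. unit_top_eigenvector (A - null_mean n d p) u \<and>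
     top_abs_entries k u T \<and> T \<noteq> S}"

lemma spectral_failure_prob:
  fixes n d k :: nat and p :: real
  assumes d: "d \<ge> 3" and p: "0 \<le> p" "p < 1" and k: "100 \<le> k" "k \<le> n" "d \<le> k" and t: "t \<ge> 0"
  defines "a \<equiv> (1 - p) * real ((k - 2) choose (d - 2))"
  assumes \<rho>: "a + 8 * real d * sqrt (real (n ^ (d - 2)) * real n) \<le> a * real k / 100"
    and \<zeta>: "8 * real d * sqrt (real (n ^ (d - 3)) * real n) \<le> a * real k / sqrt (real k)"
    and t': "t \<le> a * real k / sqrt (real k) / 10"
  shows "measure_pmf.prob (HPC n d k p) (spectral_failure n d k p)
    \<le> 2 * exp (- real n) +
       real n * (4 * exp (- real n) + 2 * exp (- 2 * t\<^sup>2 / (real d * real (n ^ (d - 2)))))"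
    (is "_ \<le> ?b")
  unfolding HPC_def
proof (rule prob_bind_pmf_le)
  fix S assume "S \<in> set_pmf (pmf_of_set {S. S \<subseteq> {0..<n} \<and> card S = k})"
  moreover have "finite {S. S \<subseteq> {0..<n} \<and> card S = k}"
    by (rule finite_subset[of _ "Pow {0..<n}"]) auto
  moreover have "{S. S \<subseteq> {0..<n} \<and> card S = k} \<noteq> {}"
    using k(2) by (auto intro!: exI[of _ "{0..<k}"])
  ultimately have S: "S \<subseteq> {0..<n}" "card S = k" by auto
  let ?P = "bernoulli_product (hyperedges n d) (edge_prob p S)"
  have a: "a > 0"
    using p k d by (simp add: a_def zero_less_binomial_iff)
  let ?Bad = "{H. \<not> (\<forall>u \<mu>. top_eigenvector_of {0..<n} (planted a S (noise n d p S H)) u \<mu> \<longrightarrow>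
             (\<forall>i\<in>S. \<forall>j\<in>{0..<n} - S. \<bar>u j\<bar> < \<bar>u i\<bar>))}"
  have "H \<in> ?Bad" if H: "(adjacency n d H, S) \<in> spectral_failure n d k p" for H
  proof (rule CollectI, rule notI)
    assume good: "\<forall>u \<mu>. top_eigenvector_of {0..<n} (planted a S (noise n d p S H)) u \<mu> \<longrightarrow>
             (\<forall>i\<in>S. \<forall>j\<in>{0..<n} - S. \<bar>u j\<bar> < \<bar>u i\<bar>)"
    obtain u T where u: "unit_top_eigenvector (adjacency n d H - null_mean n d p) u"
      and T: "top_abs_entries k u T" "T \<noteq> S"
      using H unfolding spectral_failure_def by blast
    let ?B = "adjacency n d H - null_mean n d p"
    have entries: "?B $$ (i, j) = planted a S (noise n d p S H) i j" if "i < n" "j < n" for i j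
      using adjacency_minus_null_mean[OF S(1) _ _ _ that] d p by (simp only: a_def S(2))
    have dims: "dim_row ?B = n" "dim_col ?B = n" by (simp_all add: null_mean_def)
    have "n > 0" using k by simp
    note top = unit_top_eigenvector_imp_top_eigenvector_of[OF dims this entries
        sym_planted[OF sym_codegree_matrix] u]
    obtain \<mu> where "top_eigenvector_of {0..<n} (planted a S (noise n d p S H)) (vec_index u) \<mu>"
      using top(2) by blast
    hence dom: "\<forall>i\<in>S. \<forall>j\<in>{0..<n} - S. \<bar>vec_index u j\<bar> < \<bar>vec_index u i\<bar>"
      using good by blast
    have "T = S"
      by (rule top_abs_entries_unique[OF T(1)]) (use S dom top(1) in auto)
    thus False using T(2) by simp
  qed
  hence "measure_pmf.prob ?P ((\<lambda>H. (adjacency n d H, S)) -` spectral_failure n d k p)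
      \<le> measure_pmf.prob ?P ?Bad"
    by (intro measure_pmf.finite_measure_mono) auto
  also have "\<dots> \<le> ?b"
    using clique_entries_dominate_prob[OF d _ _ a S(1) _ t] p k S \<rho> \<zeta> t' by simp
  finally show "measure_pmf.prob (Pi_pmf (hyperedges n d) False
        (\<lambda>e. bernoulli_pmf (if e \<subseteq> S then 1 else p)) \<bind> (\<lambda>H. return_pmf (adjacency n d H, S)))
      (spectral_failure n d k p) \<le> ?b"
    by (simp add: map_pmf_def[symmetric] edge_prob_def[symmetric])
next
  show "0 \<le> ?b" by simp
qed

text \<open>
  The signal satisfies \<open>a \<ge> \<kappa> * k ^ (d - 2)\<close>. The noise \<open>sqrt n ^ (d - 1)\<close>, the link
  noise \<open>sqrt n ^ (d - 2)\<close> and the row fluctuation \<open>sqrt n ^ (d - 2) * sqrt (sqrt n)\<close> are to be compared with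
  \<open>a * k\<close>, \<open>a * sqrt k\<close> and \<open>a * sqrt k\<close>. In each case replacing \<open>sqrt n\<close> by \<open>\<delta> * k\<close> gives a bound of the
  right order, with at least one factor \<open>\<delta>\<close> to spare because \<open>d \<ge> 3\<close>.
\<close>
lemma signal_dominates:
  fixes n d k :: nat and p \<delta> :: real
  assumes d: "d \<ge> 3" and p: "0 \<le> p" "p < 1" and k: "200 \<le> k" "d \<le> k"
  defines "\<kappa> \<equiv> (1 - p) / (2 * real (d - 2)) ^ (d - 2)"
  assumes \<delta>: "0 < \<delta>" "\<delta> \<le> 1" "1600 * real d * \<delta> \<le> \<kappa>" and n: "sqrt (real n) \<le> \<delta> * real k"
  defines "a \<equiv> (1 - p) * real ((k - 2) choose (d - 2))"
  shows "a + 8 * real d * sqrt (real (n ^ (d - 2)) * real n) \<le> a * real k / 100"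
    and "8 * real d * sqrt (real (n ^ (d - 3)) * real n) \<le> a * real k / sqrt (real k)"
    and "sqrt (real (n ^ (d - 2)) * sqrt (real n)) \<le> a * real k / sqrt (real k) / 10"
proof -
  define s where "s = sqrt (real n)"
  obtain m where m: "d = m + 3" using d by (metis add.commute le_Suc_ex)
  have s: "0 \<le> s" "s \<le> \<delta> * real k" using n by (simp_all add: s_def)
  have sqrt_pow: "sqrt (real (n ^ r) * real n) = s ^ (r + 1)" for r
    by (simp add: s_def real_sqrt_mult real_sqrt_power)
  have pow: "s ^ (r + 1) \<le> \<delta> * real k ^ (r + 1)" for r
  proof -
    have "s ^ (r + 1) \<le> (\<delta> * real k) ^ (r + 1)" using s by (intro power_mono) auto
    also have "\<dots> = \<delta> * \<delta> ^ r * real k ^ (r + 1)" by (simp add: power_mult_distrib)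
    also have "\<dots> \<le> \<delta> * 1 * real k ^ (r + 1)"
      using \<delta> by (intro mult_right_mono mult_left_mono power_le_one) auto
    finally show ?thesis by simp
  qed
  have low: "\<kappa> * real k ^ (d - 2) \<le> a"
  proof -
    have "real k / (2 * real (d - 2)) \<le> real (k - 2) / real (d - 2)"
    proof -
      have "real k / 2 \<le> real (k - 2)" using k by simp
      hence "real k / 2 / real (d - 2) \<le> real (k - 2) / real (d - 2)"
        by (rule divide_right_mono) simp
      thus ?thesis by simp
    qed
    hence "(real k / (2 * real (d - 2))) ^ (d - 2) \<le> (real (k - 2) / real (d - 2)) ^ (d - 2)"
      using d by (intro power_mono) auto
    also have "\<dots> \<le> real ((k - 2) choose (d - 2))"
      using k d by (intro binomial_ge_n_over_k_pow_k) auto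
    finally have "(1 - p) * (real k / (2 * real (d - 2))) ^ (d - 2) \<le> a"
      using p unfolding a_def by (intro mult_left_mono) auto
    thus ?thesis by (simp add: \<kappa>_def power_divide)
  qed
  have \<kappa>: "\<kappa> > 0" using p d by (simp add: \<kappa>_def)
  have kpos: "real k > 0" using k by simp
  have a0: "a \<ge> 0" using p by (simp add: a_def)
  have big: "8 * real d * \<delta> * real k ^ (d - 2) \<le> a / 200"
  proof -
    have "1600 * real d * \<delta> * real k ^ (d - 2) \<le> \<kappa> * real k ^ (d - 2)"
      using \<delta> by (intro mult_right_mono) auto
    thus ?thesis using low by simp
  qed
  have "8 * real d * sqrt (real (n ^ (d - 2)) * real n) \<le> 8 * real d * (\<delta> * real k ^ (d - 2 + 1))"
    unfolding sqrt_pow by (intro mult_left_mono pow) auto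
  also have "\<dots> = 8 * real d * \<delta> * real k ^ (d - 2) * real k" by simp
  also have "\<dots> \<le> a / 200 * real k" using kpos by (intro mult_right_mono big) auto
  finally have "8 * real d * sqrt (real (n ^ (d - 2)) * real n) \<le> a / 200 * real k" .
  moreover have "a * 200 \<le> a * real k" using k a0 by (intro mult_left_mono) auto
  ultimately show "a + 8 * real d * sqrt (real (n ^ (d - 2)) * real n) \<le> a * real k / 100"
    by simp
  have ak: "a * real k / sqrt (real k) = a * sqrt (real k)"
    using kpos by (simp add: field_simps)
  have "1 \<le> sqrt (real k)" using k by simp
  hence a_le: "a \<le> a * sqrt (real k)" using mult_left_mono[OF _ a0, of 1 "sqrt (real k)"] by simp
  have "8 * real d * sqrt (real (n ^ (d - 3)) * real n) \<le> 8 * real d * (\<delta> * real k ^ (d - 3 + 1))"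
    unfolding sqrt_pow by (intro mult_left_mono pow) auto
  also have "\<dots> = 8 * real d * \<delta> * real k ^ (d - 2)" by (simp add: m)
  finally show "8 * real d * sqrt (real (n ^ (d - 3)) * real n) \<le> a * real k / sqrt (real k)"
    unfolding ak using big a_le a0 by linarith
  have "sqrt (real (n ^ (d - 2)) * sqrt (real n)) = s ^ (d - 3 + 1) * sqrt s"
    by (simp add: s_def real_sqrt_mult real_sqrt_power m)
  also have "\<dots> \<le> \<delta> * real k ^ (d - 3 + 1) * sqrt (real k)"
  proof (intro mult_mono pow)
    have "\<delta> * real k \<le> 1 * real k" using \<delta> by (intro mult_right_mono) auto
    thus "sqrt s \<le> sqrt (real k)" using s by simp
  qed (use s \<delta> in auto)
  also have "\<dots> \<le> a / 10 * sqrt (real k)"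
  proof (rule mult_right_mono)
    have "1 * (\<delta> * real k ^ (d - 2)) \<le> real d * (\<delta> * real k ^ (d - 2))"
      using d \<delta> by (intro mult_right_mono) auto
    moreover have "8 * real d * \<delta> * real k ^ (d - 2) = 8 * (real d * (\<delta> * real k ^ (d - 2)))"
      by (simp only: mult.assoc)
    moreover have "d - 3 + 1 = d - 2" by (simp add: m)
    ultimately show "\<delta> * real k ^ (d - 3 + 1) \<le> a / 10"
      using big a0 by (simp only:)
  qed simp
  finally show "sqrt (real (n ^ (d - 2)) * sqrt (real n)) \<le> a * real k / sqrt (real k) / 10"
    unfolding ak by simp
qed

theorem theorem3p2:
  fixes d :: nat and p :: real and k :: "nat \<Rightarrow> nat"
    and M :: "nat \<Rightarrow> 'w measure"
    and A :: "nat \<Rightarrow> 'w \<Rightarrow> real mat"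
    and S :: "nat \<Rightarrow> 'w \<Rightarrow> nat set"
    and u :: "nat \<Rightarrow> 'w \<Rightarrow> real Matrix.vec"
    and Shat :: "nat \<Rightarrow> 'w \<Rightarrow> nat set"
  assumes "d \<ge> 3" and "0 < p" and "p < 1"
    and "\<And>n. n \<ge> 1 \<Longrightarrow> 0 < k n \<and> k n \<le> n"
    and "(\<lambda>n. (p / (1 - p)) powr (1 / (2 * (real d - 1))) * sqrt (real n) / real (k n))
           \<longlonglongrightarrow> 0"
    and "\<And>n. n \<ge> 1 \<Longrightarrow> prob_space (M n)"
    and "\<And>n. n \<ge> 1 \<Longrightarrow> (\<lambda>\<omega>. (A n \<omega>, S n \<omega>)) \<in> measurable (M n) (count_space UNIV)"
    and "\<And>n. n \<ge> 1 \<Longrightarrow>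
           distr (M n) (count_space UNIV) (\<lambda>\<omega>. (A n \<omega>, S n \<omega>)) = measure_pmf (HPC n d (k n) p)"
    and "\<And>n \<omega>. n \<ge> 1 \<Longrightarrow> \<omega> \<in> space (M n) \<Longrightarrow>
           unit_top_eigenvector (A n \<omega> - null_mean n d p) (u n \<omega>)"
    and "\<And>n \<omega>. n \<ge> 1 \<Longrightarrow> \<omega> \<in> space (M n) \<Longrightarrow> top_abs_entries (k n) (u n \<omega>) (Shat n \<omega>)"
    and "\<And>n. n \<ge> 1 \<Longrightarrow> Shat n \<in> measurable (M n) (count_space UNIV)"
  shows "(\<lambda>n. measure (M n) {\<omega> \<in> space (M n). Shat n \<omega> = S n \<omega>}) \<longlonglongrightarrow> 1"
proof -
  note d = assms(1) and p0 = assms(2) and p1 = assms(3) and kn = assms(4)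
  define \<kappa> where "\<kappa> = (1 - p) / (2 * real (d - 2)) ^ (d - 2)"
  define \<delta> where "\<delta> = min 1 (\<kappa> / (1600 * real d))"
  have \<kappa>: "\<kappa> > 0" using p1 d by (simp add: \<kappa>_def)
  have \<delta>: "0 < \<delta>" "\<delta> \<le> 1" using \<kappa> d by (simp_all add: \<delta>_def)
  have "\<delta> \<le> \<kappa> / (1600 * real d)" by (simp add: \<delta>_def)
  hence \<delta>\<kappa>: "1600 * real d * \<delta> \<le> \<kappa>" using d by (simp add: field_simps)
  define \<beta> where "\<beta> = (\<lambda>n::nat. 2 * exp (- real n) +
       real n * (4 * exp (- real n) + 2 * exp (- (2 / real d * sqrt (real n)))))"
  have fail: "1 - \<beta> n \<le> measure (M n) {\<omega> \<in> space (M n). Shat n \<omega> = S n \<omega>}"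
    if n1: "n \<ge> 1" and nk: "sqrt (real n) \<le> \<delta> * real (k n)" and k: "200 \<le> k n" "d \<le> k n" for n
  proof -
    interpret prob_space "M n" by (rule assms(6)[OF n1])
    have k_le: "k n \<le> n" using kn[OF n1] by simp
    \<comment> \<open>Fluctuation allowed in a leave-one-out row. The extra factor \<open>sqrt (sqrt n)\<close> makes the tail
      \<open>exp (- 2 * sqrt n / d)\<close>, which survives a union over \<open>n\<close> vertices, and is still dominated
      by the signal.\<close>
    define t where "t = sqrt (real (n ^ (d - 2)) * sqrt (real n))"
    have "t\<^sup>2 = real (n ^ (d - 2)) * sqrt (real n)" by (simp add: t_def)
    hence t2: "- 2 * t\<^sup>2 / (real d * real (n ^ (d - 2))) = - (2 / real d * sqrt (real n))"
      using n1 by simp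
    note signal = signal_dominates[OF d _ p1 k \<delta> \<delta>\<kappa>[unfolded \<kappa>_def] nk]
    have pmf: "measure_pmf.prob (HPC n d (k n) p) (spectral_failure n d (k n) p) \<le> \<beta> n"
      using spectral_failure_prob[OF d _ p1 _ k_le k(2) _ signal(1,2) signal(3)[folded t_def]] p0 k
      unfolding \<beta>_def t2 by (simp add: t_def)
    let ?F = "(\<lambda>\<omega>. (A n \<omega>, S n \<omega>)) -` spectral_failure n d (k n) p \<inter> space (M n)"
    let ?R = "{\<omega> \<in> space (M n). Shat n \<omega> = S n \<omega>}"
    have F: "?F \<in> events" using assms(7)[OF n1] by (rule measurable_sets) simp
    have "prob ?F = measure_pmf.prob (HPC n d (k n) p) (spectral_failure n d (k n) p)"
      unfolding assms(8)[OF n1, symmetric] by (rule measure_distr[symmetric, OF assms(7)[OF n1]]) simp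
    hence F_le: "prob ?F \<le> \<beta> n" using pmf by simp
    have dim: "dim_vec (u n \<omega>) = n" if "\<omega> \<in> space (M n)" for \<omega>
      using assms(9)[OF n1 that] unfolding unit_top_eigenvector_def eigenvector_def
      by (auto simp: null_mean_def)
    have sub: "Shat n \<omega> \<in> Pow {0..<n}" if "\<omega> \<in> space (M n)" for \<omega>
      using assms(10)[OF n1 that] dim[OF that] by (simp add: top_abs_entries_def)
    \<comment> \<open>A finite union over the possible values: for random variables with values in a discrete
      measurable space that is not countable, equality need not be measurable.\<close>
    have "?R = (\<Union>T\<in>Pow {0..<n}. (Shat n -` {T} \<inter> space (M n)) \<inter>
        ((\<lambda>\<omega>. (A n \<omega>, S n \<omega>)) -` {z. snd z = T} \<inter> space (M n)))"
      using sub by auto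
    also have "\<dots> \<in> events"
      using assms(11)[OF n1] assms(7)[OF n1]
      by (intro sets.finite_UN sets.Int measurable_sets[OF assms(11)[OF n1]]
          measurable_sets[OF assms(7)[OF n1]]) auto
    finally have R: "?R \<in> events" .
    have "space (M n) - ?F \<subseteq> ?R"
    proof
      fix \<omega> assume w: "\<omega> \<in> space (M n) - ?F"
      hence "\<omega> \<in> space (M n)" "(A n \<omega>, S n \<omega>) \<notin> spectral_failure n d (k n) p" by auto
      thus "\<omega> \<in> ?R"
        using assms(9,10)[OF n1, of \<omega>] unfolding spectral_failure_def by auto
    qed
    hence "prob (space (M n) - ?F) \<le> prob ?R"
      using R by (intro finite_measure_mono)
    thus ?thesis using prob_compl[OF F] F_le by simp
  qed
  have "eventually (\<lambda>n. 1 - \<beta> n \<le> measure (M n) {\<omega> \<in> space (M n). Shat n \<omega> = S n \<omega>}) sequentially"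
  proof -
    \<comment> \<open>With \<open>p\<close> fixed, the factor depending on \<open>p\<close> is a positive constant, so the growth condition
      says that \<open>sqrt n / k\<close> tends to \<open>0\<close>; in particular \<open>k\<close> tends to infinity.\<close>
    define c where "c = (p / (1 - p)) powr (1 / (2 * (real d - 1)))"
    have c: "c > 0" using p0 p1 by (simp add: c_def)
    have "eventually (\<lambda>n. c * sqrt (real n) / real (k n) < c * \<delta>) sequentially"
      using assms(5) c \<delta> unfolding c_def[symmetric] by (intro order_tendstoD(2)[of _ 0]) auto
    moreover have "eventually (\<lambda>n. real n \<ge> (real (max 200 d))\<^sup>2) sequentially"
      by real_asymp
    moreover have "eventually (\<lambda>n::nat. n \<ge> 1) sequentially" by (rule eventually_ge_at_top)
    ultimately show ?thesis
    proof eventually_elim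
      case (elim n)
      have kpos: "real (k n) > 0" using kn[of n] elim(3) by simp
      have "c * (sqrt (real n) / real (k n)) < c * \<delta>" using elim(1) by simp
      hence nk: "sqrt (real n) \<le> \<delta> * real (k n)"
        using c kpos by (simp add: pos_divide_less_eq)
      have "real (max 200 d) \<le> sqrt (real n)"
        using elim(2) by (rule real_le_rsqrt)
      also have "\<dots> \<le> 1 * real (k n)"
        using nk mult_right_mono[OF \<delta>(2), of "real (k n)"] by simp
      finally have "max 200 d \<le> k n" by simp
      thus ?case using fail[OF elim(3) nk] by simp
    qed
  qed
  moreover have "eventually (\<lambda>n. measure (M n) {\<omega> \<in> space (M n). Shat n \<omega> = S n \<omega>} \<le> 1) sequentially"
    using eventually_ge_at_top[of 1]
    by eventually_elim (rule prob_space.prob_le_1, rule assms(6))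
  moreover have "(\<lambda>n. 1 - \<beta> n) \<longlonglongrightarrow> 1"
  proof -
    have "2 / real d > 0" using d by simp
    thus ?thesis unfolding \<beta>_def by real_asymp
  qed
  ultimately show ?thesis
    using tendsto_sandwich[of "\<lambda>n. 1 - \<beta> n" _ sequentially "\<lambda>_. 1" 1] by simp
qed

end
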